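(* Let $G$ be a connected graph that is $(\mathrm{bull}, \mathrm{chair})$-free, i.e. $G$ contains neither the bull nor the chair as an induced subgraph. Then at least one of the following holds: (i) $G$ contains an odd wheel; (ii) $G$ contains a (not necessarily induced) spindle graph $M_{3i+1}$ for some $i\geq 1$, i.e. $G$ has a subgraph isomorphic to $M_{3i+1}$; (iii) $G$ is $3$-colourable.
   Context: All graphs are finite, simple and undirected. The bull is the graph on vertices $v_1,\dots,v_5$ with edges $v_1v_2, v_2v_3, v_3v_4, v_4v_5, v_2v_4$ (a triangle with two pendant edges at two of its vertices). For integers $i,j,k\ge 1$, $S_{i,j,k}$ is the graph consisting of three induced paths of lengths $i$, $j$ and $k$ sharing a common initial vertex and otherwise disjoint, with no further edges; the chair is $S_{1,1,2}$. An odd wheel $W_{2t+1}$ ($t\ge 1$) is the graph obtained from a cycle of length $2t+1$ by adding a vertex adjacent to all vertices of the cycle. For $p\ge 1$, a spindle graph $M_{3p+1}$ is a graph of order $3p+1$ containing a cycle $u_0u_1\cdots u_{3p}u_0$ (indices modulo $3p+1$) such that for each $i\in\{1,\dots,p\}$ one has $N(u_{3i})=\{u_{3i-2},u_{3i-1},u_{3i+1},u_{3i+2}\}$ and $N(u_{3i-1})\cap N(u_{3i-2})=\{u_{3i-3},u_{3i}\}$. (E.g. $M_4\cong K_4$ and $M_7$ is the Moser spindle; every $M_{3p+1}$ is not $3$-colourable.)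
   Formalization: In the definition of the spindle graph, the condition at i = p is corrected to N(u_{3p}) = {u_{3p-2}, u_{3p-1}, u_0}; the literal cyclic reading adds the edge u_{3p}u_1, so M_7 would not be the Moser spindle, which would then be a counterexample. *)

theory Defs
  imports
    "Graph_Theory.Digraph_Component"
    "Graph_Theory.Digraph_Isomorphism"
begin

text \<open>
  A finite simple undirected graph is a \<^locale>\<open>pair_graph\<close>: finite, loop-free, without parallel
  arcs, and with every edge present as a pair of opposite arcs.
\<close>

definition undirected :: "'a set \<Rightarrow> 'a rel \<Rightarrow> 'a pair_pre_digraph" where
  "undirected V E = \<lparr> pverts = V, parcs = E \<union> E\<inverse> \<rparr>"

definition nbhd :: "'a pair_pre_digraph \<Rightarrow> 'a \<Rightarrow> 'a set" where
  "nbhd G v = {w. (v, w) \<in> parcs G}"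

definition contains_induced :: "'a pair_pre_digraph \<Rightarrow> 'b pair_pre_digraph \<Rightarrow> bool" where
  "contains_induced G H \<longleftrightarrow>
     (\<exists>K :: 'a pair_pre_digraph.
        induced_subgraph (with_proj K) (with_proj G) \<and> digraph_iso (with_proj H) (with_proj K))"

definition colourable :: "nat \<Rightarrow> 'a pair_pre_digraph \<Rightarrow> bool" where
  "colourable k G \<longleftrightarrow>
     (\<exists>c :: 'a \<Rightarrow> nat. (\<forall>v \<in> pverts G. c v < k) \<and> (\<forall>(v, w) \<in> parcs G. c v \<noteq> c w))"

definition bull :: "nat pair_pre_digraph" where
  "bull = undirected {1..5} {(1, 2), (2, 3), (3, 4), (4, 5), (2, 4)}"

text \<open>
  In \<^term>\<open>S_graph i j k\<close>, the vertex \<open>(0, 0)\<close> is the common initial vertex of the three paths and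
  \<open>(a, m)\<close> is the vertex at distance \<open>m\<close> from it on the \<open>a\<close>-th path.
\<close>

definition S_graph :: "nat \<Rightarrow> nat \<Rightarrow> nat \<Rightarrow> (nat \<times> nat) pair_pre_digraph" where
  "S_graph i j k =
     (let V = {1} \<times> {1..i} \<union> {2} \<times> {1..j} \<union> {3} \<times> {1..k} in
      undirected (insert (0, 0) V)
        ({((0, 0), (a, 1)) | a. (a, 1) \<in> V} \<union>
         {((a, m), (a, Suc m)) | a m. (a, m) \<in> V \<and> (a, Suc m) \<in> V}))"

definition chair :: "(nat \<times> nat) pair_pre_digraph" where
  "chair = S_graph 1 1 2"

text \<open>The wheel with rim \<open>0, \<dots>, n - 1\<close> and hub \<open>n\<close>.\<close>

definition wheel :: "nat \<Rightarrow> nat pair_pre_digraph" where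
  "wheel n = undirected {0..n} ({(i, Suc i mod n) | i. i < n} \<union> {(i, n) | i. i < n})"

text \<open>
  \<^term>\<open>spindle p H\<close> says that \<open>H\<close> is a spindle graph $M_{3p+1}$, with spanning cycle
  $u_0 u_1 \ldots u_{3p} u_0$.

  The last vertex $u_{3p}$ is adjacent to $u_{3p-2}$, $u_{3p-1}$ and $u_0$ only. Reading the
  condition $N(u_{3i}) = \{u_{3i-2}, u_{3i-1}, u_{3i+1}, u_{3i+2}\}$ cyclically also for $i = p$
  would add the edge $u_{3p} u_1$; for $p = 2$ this gives a graph with 12 edges instead of the
  Moser spindle, which has 11 and is a connected non-3-colourable graph without induced bulls,
  chairs and odd wheels. For $p = 1$ the two readings agree and give $K_4$.
\<close>

definition spindle :: "nat \<Rightarrow> 'a pair_pre_digraph \<Rightarrow> bool" where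
  "spindle p H \<longleftrightarrow> pair_graph H \<and>
     (\<exists>u :: nat \<Rightarrow> 'a. bij_betw u {0..3 * p} (pverts H) \<and>
        (\<forall>i \<in> {0..3 * p}. (u i, u (Suc i mod (3 * p + 1))) \<in> parcs H) \<and>
        (\<forall>i \<in> {1..<p}.
           nbhd H (u (3 * i)) = {u (3 * i - 2), u (3 * i - 1), u (3 * i + 1), u (3 * i + 2)}) \<and>
        nbhd H (u (3 * p)) = {u (3 * p - 2), u (3 * p - 1), u 0} \<and>
        (\<forall>i \<in> {1..p}.
           nbhd H (u (3 * i - 1)) \<inter> nbhd H (u (3 * i - 2)) = {u (3 * i - 3), u (3 * i)}))"

end

theory Submission
  imports Defs
begin

text \<open>
  A minimal subgraph that is not 3-colourable is vertex-critical, and we derive a contradiction from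
  it being free of bulls, chairs, odd wheels and spindles.

  Suppose first that it has an odd hole \<open>C\<close>. Bulls and chairs force every other vertex to be a
  clone of a hole vertex, so the graph is \<open>C\<close> with some vertices doubled, no two of them
  consecutive. A doubled vertex turns its two hole neighbours into the ends of a diamond, which
  receive equal colours. So the graph is 3-colourable if at least two edges of \<open>C\<close> join undoubled
  vertices, and it is a spindle if there is exactly one; by parity there cannot be none.

  If there is no odd hole, then in every 3-colouring of \<open>G - v\<close> each pair of colours occurs on an edge
  inside \<open>N(v)\<close>, because a shortest Kempe chain between neighbours of \<open>v\<close> would otherwise close
  up to an odd hole. This forces every \<open>N(v)\<close> to be connected, of maximum degree two, and to contain
  an induced path on four vertices \<open>p\<^sub>1 p\<^sub>2 p\<^sub>3 p\<^sub>4\<close>. The same property of \<open>N(p\<^sub>2)\<close> and \<open>N(p\<^sub>3)\<close> yields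
  diamonds \<open>w p\<^sub>1 p\<^sub>2 v\<close> and \<open>v p\<^sub>3 p\<^sub>4 z\<close>, and \<open>w z\<close> is an edge since there is no bull. This is the
  Moser spindle.
\<close>

definition proper3 :: "('a \<Rightarrow> 'a \<Rightarrow> bool) \<Rightarrow> 'a set \<Rightarrow> ('a \<Rightarrow> nat) \<Rightarrow> bool" where
  "proper3 E X f \<longleftrightarrow> (\<forall>x\<in>X. f x < 3) \<and> (\<forall>x\<in>X. \<forall>y\<in>X. E x y \<longrightarrow> f x \<noteq> f y)"

text \<open>An odd hole of length \<open>n\<close>, indexed by all integers, with indices read modulo \<open>n\<close>.\<close>

definition hole :: "('a \<Rightarrow> 'a \<Rightarrow> bool) \<Rightarrow> int \<Rightarrow> (int \<Rightarrow> 'a) \<Rightarrow> bool" where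
  "hole E n c \<longleftrightarrow> odd n \<and> n \<ge> 5 \<and> (\<forall>i j. c i = c j \<longleftrightarrow> n dvd (i - j)) \<and>
     (\<forall>i j. E (c i) (c j) \<longleftrightarrow> n dvd (i - j - 1) \<or> n dvd (i - j + 1))"

text \<open>\<open>x\<close> and \<open>y\<close> are the ends; \<open>x = y\<close> or an edge between them is not excluded.\<close>

definition diamond :: "('a \<Rightarrow> 'a \<Rightarrow> bool) \<Rightarrow> 'a \<Rightarrow> 'a \<Rightarrow> 'a \<Rightarrow> 'a \<Rightarrow> bool" where
  "diamond E x a b y \<longleftrightarrow> E x a \<and> E x b \<and> E a b \<and> E a y \<and> E b y"

lemma dvd_close_eq:
  assumes "(n::int) \<ge> 5" "n dvd a" "n dvd b" "\<bar>a - b\<bar> < 5"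
  shows "a = b"
proof (rule ccontr)
  assume "a \<noteq> b"
  then have "n \<le> \<bar>a - b\<bar>"
    using assms(1-3) zdvd_imp_le[of n "\<bar>a - b\<bar>"] by auto
  then show False using assms by linarith
qed

lemma dvd_shift:
  "(n::int) dvd (i - j) \<Longrightarrow> n dvd (l - i + e) \<longleftrightarrow> n dvd (l - j + e)"
proof -
  assume "n dvd (i - j)"
  moreover have "l - j + e = (l - i + e) + (i - j)" by simp
  ultimately show ?thesis by (metis dvd_add_left_iff)
qed

lemma int_mod_succ: "0 < (n::int) \<Longrightarrow> (j + 1) mod n = (if j mod n = n - 1 then 0 else j mod n + 1)"
proof -
  assume n: "0 < n"
  have eq: "(j + 1) mod n = (j mod n + 1) mod n" by (simp add: mod_add_left_eq)
  have "0 \<le> j mod n" "j mod n < n" using n by simp_all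
  then show ?thesis unfolding eq by auto
qed

locale critical_graph =
  fixes V :: "'a set" and E :: "'a \<Rightarrow> 'a \<Rightarrow> bool"
  assumes fin: "finite V"
    and E_in: "E x y \<Longrightarrow> x \<in> V \<and> y \<in> V"
    and sym: "E x y \<Longrightarrow> E y x"
    and irrefl: "\<not> E x x"
    and no_bull: "\<lbrakk>E a b; E b c; E c d; E d e; E b d; \<not> E a c; \<not> E a d; \<not> E a e; \<not> E b e; \<not> E c e\<rbrakk>
      \<Longrightarrow> False"
    and no_chair: "\<lbrakk>E m x; E m y; E m z; E z w; x \<noteq> y; \<not> E x y; \<not> E x z; \<not> E y z;
      \<not> E m w; \<not> E x w; \<not> E y w\<rbrakk> \<Longrightarrow> False"
    and no_K4: "\<lbrakk>E a b; E a c; E a d; E b c; E b d; E c d\<rbrakk> \<Longrightarrow> False"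
    and no_wheel: "\<lbrakk>hole E n r; \<And>i. E h (r i)\<rbrakk> \<Longrightarrow> False"
    and no_spindle: "\<lbrakk>p \<ge> 1; inj_on u {0..3 * p :: nat};
      \<And>i. i < p \<Longrightarrow> diamond E (u (3 * i)) (u (3 * i + 1)) (u (3 * i + 2)) (u (3 * i + 3));
      E (u (3 * p)) (u 0)\<rbrakk> \<Longrightarrow> False"
    and not_colourable: "\<not> proper3 E V f"
    and critical: "v \<in> V \<Longrightarrow> \<exists>f. proper3 E (V - {v}) f"
begin

lemma sym_iff: "E x y \<longleftrightarrow> E y x"
  using sym by blast

lemma no_moser:
  assumes "diamond E w a b v" "diamond E v c d z" "E z w" "distinct [w, a, b, v, c, d, z]"
  shows False
proof (rule no_spindle[of 2 "(!) [w, a, b, v, c, d, z]"])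
  show "inj_on ((!) [w, a, b, v, c, d, z]) {0..3 * 2}"
    using assms(4) by (intro inj_on_nth) auto
  show "diamond E ([w,a,b,v,c,d,z] ! (3 * i)) ([w,a,b,v,c,d,z] ! (3 * i + 1))
      ([w,a,b,v,c,d,z] ! (3 * i + 2)) ([w,a,b,v,c,d,z] ! (3 * i + 3))" if "i < 2" for i
  proof -
    have "i = 0 \<or> i = 1" using that by auto
    then show ?thesis using assms(1,2) by (auto simp: numeral_eq_Suc)
  qed
qed (use assms(3) in \<open>auto simp: numeral_eq_Suc\<close>)

lemma proper3I:
  assumes "\<And>x. x \<in> X \<Longrightarrow> f x < 3" "\<And>x y. x \<in> X \<Longrightarrow> y \<in> X \<Longrightarrow> E x y \<Longrightarrow> f x \<noteq> f y"
  shows "proper3 E X f"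
  using assms by (auto simp: proper3_def)

lemma connected_set:
  assumes "S \<subseteq> V" "S \<noteq> {}" "\<And>x y. x \<in> S \<Longrightarrow> E x y \<Longrightarrow> y \<in> S"
  shows "S = V"
proof (rule ccontr)
  assume "S \<noteq> V"
  then obtain t s where t: "t \<in> V" "t \<notin> S" and s: "s \<in> S" using assms by blast
  obtain f where f: "proper3 E (V - {t}) f" using critical t by blast
  obtain g where g: "proper3 E (V - {s}) g" using critical s assms by blast
  have "proper3 E V (\<lambda>x. if x \<in> S then f x else g x)"
  proof (rule proper3I)
    fix x assume "x \<in> V"
    then show "(if x \<in> S then f x else g x) < 3"
      using f g s t by (auto simp: proper3_def)
  next
    fix x y assume xy: "x \<in> V" "y \<in> V" "E x y"
    then have "x \<in> S \<longleftrightarrow> y \<in> S" using assms(3) sym by blast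
    then show "(if x \<in> S then f x else g x) \<noteq> (if y \<in> S then f y else g y)"
      using f g s t xy by (auto simp: proper3_def)
  qed
  then show False using not_colourable by blast
qed

lemma third_neighbour:
  assumes "v \<in> V"
  shows "\<exists>x. E v x \<and> x \<noteq> a \<and> x \<noteq> b"
proof (rule ccontr)
  assume none: "\<not> ?thesis"
  obtain f where f: "proper3 E (V - {v}) f" using critical assms by blast
  have "\<exists>k\<in>{0, 1, 2::nat}. k \<noteq> f a \<and> k \<noteq> f b" by auto
  then obtain k where "k \<in> {0, 1, 2::nat}" and k: "k \<noteq> f a" "k \<noteq> f b" by blast
  then have "k < 3" by auto
  have "proper3 E V (f(v := k))"
  proof (rule proper3I)
    show "(f(v := k)) x < 3" if "x \<in> V" for x
      using that f \<open>k < 3\<close> by (auto simp: proper3_def)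
    show "(f(v := k)) x \<noteq> (f(v := k)) y" if "x \<in> V" "y \<in> V" "E x y" for x y
    proof (cases "x = v \<or> y = v")
      case True
      then show ?thesis using that none k irrefl sym[of x y] by (metis fun_upd_apply)
    next
      case False
      then show ?thesis using that f by (auto simp: proper3_def)
    qed
  qed
  then show False using not_colourable by blast
qed

section \<open>Odd holes\<close>

definition clone :: "int \<Rightarrow> (int \<Rightarrow> 'a) \<Rightarrow> int \<Rightarrow> 'a \<Rightarrow> bool" where
  "clone n c i x \<longleftrightarrow> (\<forall>j. E x (c j) \<longleftrightarrow> n dvd (j - i + 1) \<or> n dvd (j - i) \<or> n dvd (j - i - 1))"

text \<open>Says nothing about the pair \<open>x\<close>, \<open>c i\<close>, so that \<open>c i\<close> is itself a twin at \<open>i\<close>, and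
  replacing \<open>c i\<close> by any twin gives a hole again.\<close>

definition twin :: "int \<Rightarrow> (int \<Rightarrow> 'a) \<Rightarrow> int \<Rightarrow> 'a \<Rightarrow> bool" where
  "twin n c i x \<longleftrightarrow> (\<forall>j. \<not> n dvd (j - i) \<longrightarrow> (E x (c j) \<longleftrightarrow> n dvd (j - i - 1) \<or> n dvd (j - i + 1)))"

lemma clone_imp_twin: "clone n c i x \<Longrightarrow> twin n c i x"
  by (auto simp: clone_def twin_def)

lemma hole_shift: "hole E n c \<Longrightarrow> hole E n (\<lambda>j. c (j + k))"
  by (auto simp: hole_def)

lemma hole_reflect: "hole E n c \<Longrightarrow> hole E n (\<lambda>j. c (- j))"
proof -
  assume h: "hole E n c"
  have "n dvd (- i - - j) \<longleftrightarrow> n dvd (i - j)" for i j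
    using dvd_minus_iff[of n "i - j"] by simp
  moreover have "n dvd (- i - - j - 1) \<longleftrightarrow> n dvd (i - j + 1)" for i j
    using dvd_minus_iff[of n "i - j + 1"] by (simp add: algebra_simps)
  moreover have "n dvd (- i - - j + 1) \<longleftrightarrow> n dvd (i - j - 1)" for i j
    using dvd_minus_iff[of n "i - j - 1"] by (simp add: algebra_simps)
  ultimately show ?thesis using h unfolding hole_def by blast
qed

context
  fixes n c
  assumes h: "hole E n c"
begin

lemma hole_ge_5: "n \<ge> 5" and hole_odd: "odd n"
  and hole_eq_iff: "c i = c j \<longleftrightarrow> n dvd (i - j)"
  and hole_adj_iff: "E (c i) (c j) \<longleftrightarrow> n dvd (i - j - 1) \<or> n dvd (i - j + 1)"
  using h by (auto simp: hole_def)

lemma hole_not_dvd: "d \<noteq> 0 \<Longrightarrow> \<bar>d\<bar> < 5 \<Longrightarrow> \<not> n dvd d"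
  using dvd_close_eq[OF hole_ge_5, of d 0] by auto

lemmas hole_not_dvd_numeral = hole_not_dvd[of 1, simplified] hole_not_dvd[of 2, simplified]
  hole_not_dvd[of 3, simplified] hole_not_dvd[of 4, simplified]

lemma hole_dvd_unique: "n dvd a \<Longrightarrow> n dvd b \<Longrightarrow> a \<noteq> b \<Longrightarrow> \<bar>a - b\<bar> < 5 \<Longrightarrow> False"
  using dvd_close_eq[OF hole_ge_5] by blast

lemma hole_in_V: "c i \<in> V"
  using E_in[of "c i" "c (i + 1)"] by (simp add: hole_adj_iff)

lemma isolated_nbr:
  assumes "v \<notin> range c" "E v (c i)" "\<not> E v (c (i - 1))" "\<not> E v (c (i + 1))"
  shows "E v (c (i + 2))"
proof (rule ccontr)
  assume "\<not> ?thesis"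
  moreover have "v \<noteq> c (i - 1)" using assms by auto
  moreover have "E (c i) (c (i - 1))" "E (c i) (c (i + 1))" "E (c (i + 1)) (c (i + 2))"
    "\<not> E (c (i - 1)) (c (i + 1))" "\<not> E (c i) (c (i + 2))" "\<not> E (c (i - 1)) (c (i + 2))"
    by (simp_all add: hole_adj_iff hole_not_dvd_numeral)
  ultimately show False using no_chair[of "c i" v "c (i - 1)" "c (i + 1)" "c (i + 2)"] assms sym by blast
qed

lemma consecutive_nbrs:
  assumes "E v (c i)" "E v (c (i + 1))"
  shows "E v (c (i - 1)) \<or> E v (c (i + 2))"
proof (rule ccontr)
  assume "\<not> ?thesis"
  moreover have "E (c (i - 1)) (c i)" "E (c i) (c (i + 1))" "E (c (i + 1)) (c (i + 2))"
    "\<not> E (c (i - 1)) (c (i + 1))" "\<not> E (c i) (c (i + 2))" "\<not> E (c (i - 1)) (c (i + 2))"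
    by (simp_all add: hole_adj_iff hole_not_dvd_numeral)
  ultimately show False using no_bull[of "c (i - 1)" "c i" v "c (i + 1)" "c (i + 2)"] assms sym by blast
qed

lemma nbr_run_start:
  assumes "E v (c i)" "E v (c (i + 1))" "\<not> E v (c (i - 1))" "E v (c j)"
  shows "n dvd (j - i + 2) \<or> n dvd (j - i) \<or> n dvd (j - i - 1) \<or> n dvd (j - i - 2)"
proof -
  have "E (c (i - 1)) (c i)" "E (c i) (c (i + 1))" "\<not> E (c (i - 1)) (c (i + 1))"
    by (simp_all add: hole_adj_iff hole_not_dvd_numeral)
  then have "E (c (i - 1)) (c j) \<or> E (c i) (c j) \<or> E (c (i + 1)) (c j)"
    using no_bull[of "c (i - 1)" "c i" "c (i + 1)" v "c j"] assms sym by blast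
  moreover have "n dvd (i - 1 - j - 1) \<longleftrightarrow> n dvd (j - i + 2)" "n dvd (i - 1 - j + 1) \<longleftrightarrow> n dvd (j - i)"
    "n dvd (i - j - 1) \<longleftrightarrow> n dvd (j - i + 1)" "n dvd (i - j + 1) \<longleftrightarrow> n dvd (j - i - 1)"
    "n dvd (i + 1 - j - 1) \<longleftrightarrow> n dvd (j - i)" "n dvd (i + 1 - j + 1) \<longleftrightarrow> n dvd (j - i - 2)"
    using dvd_minus_iff[of n "j - i + 2"] dvd_minus_iff[of n "j - i"] dvd_minus_iff[of n "j - i + 1"]
      dvd_minus_iff[of n "j - i - 1"] dvd_minus_iff[of n "j - i - 2"] by (simp_all add: algebra_simps)
  moreover have "\<not> n dvd (j - i + 1)"
    using assms hole_eq_iff[of j "i - 1"] by (auto simp: algebra_simps)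
  ultimately show ?thesis by (simp only: hole_adj_iff) blast
qed

end

lemma nbr_run_end:
  assumes h: "hole E n c" and "E v (c i)" "E v (c (i - 1))" "\<not> E v (c (i + 1))" "E v (c j)"
  shows "n dvd (j - i - 2) \<or> n dvd (j - i) \<or> n dvd (j - i + 1) \<or> n dvd (j - i + 2)"
proof -
  have "n dvd (- j - - i + 2) \<or> n dvd (- j - - i) \<or> n dvd (- j - - i - 1) \<or> n dvd (- j - - i - 2)"
    using nbr_run_start[OF hole_reflect[OF h], of v "- i" "- j"] assms by (simp add: add.commute)
  then show ?thesis
    using dvd_minus_iff[of n "j - i + 2"] dvd_minus_iff[of n "j - i"] dvd_minus_iff[of n "j - i + 1"]
      dvd_minus_iff[of n "j - i - 2"] by (auto simp: algebra_simps)
qed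

lemma hole_nbrs_cases:
  assumes h: "hole E n c" and v: "v \<notin> range c" "E v (c k)"
  shows "(\<exists>i. clone n c i v) \<or> n = 5 \<and> (\<exists>i. \<forall>j. E v (c j) \<longleftrightarrow> \<not> n dvd (j - i))"
proof -
  have per: "E v (c i) \<longleftrightarrow> E v (c j)" if "n dvd (i - j)" for i j
    using that hole_eq_iff[OF h, of i j] by simp
  have np: "n > 0" using hole_ge_5[OF h] by linarith
  have down: "n dvd (j - (i - int (nat ((i - j) mod n))))" for i j
  proof -
    have "j - (i - (i - j) mod n) = - ((i - j) - (i - j) mod n)" by simp
    moreover have "int (nat ((i - j) mod n)) = (i - j) mod n" using np by simp
    ultimately show ?thesis by (metis dvd_minus_iff dvd_minus_mod)
  qed
  have "\<exists>i. E v (c i) \<and> E v (c (i + 1))"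
  proof (rule ccontr)
    assume none: "\<not> ?thesis"
    then have two: "E v (c (i + 2))" if "E v (c i)" for i
      using isolated_nbr[OF h v(1) that] that by (metis diff_add_cancel)
    have "E v (c (k + 2 * int m))" for m
    proof (induction m)
      case (Suc m)
      then show ?case using two[OF Suc] by (simp add: algebra_simps)
    qed (use v in simp)
    from this[of "nat ((n + 1) div 2)"] have "E v (c (k + n + 1))"
      using hole_odd[OF h] np by (simp add: algebra_simps)
    then have "E v (c (k + 1))" using per[of "k + n + 1" "k + 1"] by simp
    then show False using none v by blast
  qed
  then obtain l where l: "E v (c l)" "E v (c (l + 1))" by blast
  have "\<exists>i. E v (c i) \<and> E v (c (i + 1)) \<and> \<not> E v (c (i - 1))"
  proof (rule ccontr)
    assume none: "\<not> ?thesis"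
    then have step: "E v (c (i - 1))" if "E v (c i)" "E v (c (i + 1))" for i using that by blast
    have "E v (c (l - int m)) \<and> E v (c (l - int m + 1))" for m
    proof (induction m)
      case (Suc m)
      then show ?case using step[of "l - int m"] by (auto simp: algebra_simps)
    qed (use l in simp)
    then have "E v (c j)" for j using per[OF down[of j l]] by blast
    then show False using no_wheel[OF h] by blast
  qed
  then obtain i where i: "E v (c i)" "E v (c (i + 1))" "\<not> E v (c (i - 1))" by blast
  have i2: "E v (c (i + 2))" using consecutive_nbrs[OF h i(1,2)] i(3) by blast
  note start = nbr_run_start[OF h i]
  show ?thesis
  proof (cases "E v (c (i - 2))")
    case False
    have "clone n c (i + 1) v"
      unfolding clone_def
    proof (intro allI iffI)
      fix j assume "E v (c j)"
      moreover then have "\<not> n dvd (j - (i - 2))" using per False by blast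
      ultimately show "n dvd (j - (i + 1) + 1) \<or> n dvd (j - (i + 1)) \<or> n dvd (j - (i + 1) - 1)"
        using start[of j] by (simp add: algebra_simps)
    next
      fix j assume "n dvd (j - (i + 1) + 1) \<or> n dvd (j - (i + 1)) \<or> n dvd (j - (i + 1) - 1)"
      then have "n dvd (j - i) \<or> n dvd (j - (i + 1)) \<or> n dvd (j - (i + 2))"
        by (simp add: algebra_simps)
      then show "E v (c j)" using per i i2 by blast
    qed
    then show ?thesis by blast
  next
    case True
    have "n = 5"
    proof (rule ccontr)
      assume "n \<noteq> 5"
      then have n7: "n \<ge> 7" using hole_ge_5[OF h] hole_odd[OF h] by presburger
      have small: "\<not> n dvd d" if "d \<noteq> 0" "\<bar>d\<bar> < 7" for d
        using that n7 zdvd_imp_le[of n "\<bar>d\<bar>"] by auto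
      have "\<not> E v (c (i + 3))"
        using start[of "i + 3"] small[of 5] small[of 3] small[of 2] small[of 1] by auto
      then show False
        using nbr_run_end[OF h, of v "i + 2" "i - 2"] i i2 True
          small[of 6] small[of 4] small[of 3] small[of 2] by (auto simp: algebra_simps)
    qed
    moreover have "E v (c j) \<longleftrightarrow> \<not> 5 dvd (j - (i - 1))" for j
    proof
      assume "E v (c j)"
      then show "\<not> 5 dvd (j - (i - 1))" using per i \<open>n = 5\<close> by blast
    next
      assume "\<not> 5 dvd (j - (i - 1))"
      then have "5 dvd (j - (i - 2)) \<or> 5 dvd (j - i) \<or> 5 dvd (j - (i + 1)) \<or> 5 dvd (j - (i + 2))"
        by presburger
      then show "E v (c j)" using per i i2 True \<open>n = 5\<close> by blast
    qed
    ultimately show ?thesis by blast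
  qed
qed

text \<open>The missed vertex \<open>c i\<close> has a third neighbour \<open>x\<close>, and every possible neighbourhood of \<open>x\<close> on
  the hole completes a Moser spindle.\<close>

lemma hole_5_nbrs:
  assumes h: "hole E 5 c" and v: "v \<notin> range c" "\<And>j. E v (c j) \<longleftrightarrow> \<not> 5 dvd (j - i)"
  shows False
proof -
  obtain x where x: "E (c i) x" "x \<noteq> c (i + 1)" "x \<noteq> c (i - 1)"
    using third_neighbour[OF hole_in_V[OF h]] by blast
  have xr: "x \<notin> range c"
  proof
    assume "x \<in> range c"
    then obtain j where "x = c j" by blast
    then have "5 dvd (i - j - 1) \<or> 5 dvd (i - j + 1)" using x hole_adj_iff[OF h] by blast
    then have "5 dvd (j - (i - 1)) \<or> 5 dvd (j - (i + 1))" by presburger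
    then show False using x \<open>x = c j\<close> hole_eq_iff[OF h] by blast
  qed
  have xv: "x \<noteq> v" using x v(2)[of i] sym by auto
  have xi: "E x (c i)" using x sym by blast
  note adj = hole_adj_iff[OF h]
  have "E x (c (i + 1)) \<and> E x (c (i + 2)) \<or> E x (c (i - 1)) \<and> E x (c (i - 2))
      \<or> E x (c (i - 1)) \<and> E x (c (i + 1))"
    using hole_nbrs_cases[OF h xr xi]
  proof (elim disjE exE conjE)
    fix k assume "clone 5 c k x"
    then have k: "E x (c j) \<longleftrightarrow> 5 dvd (j - k + 1) \<or> 5 dvd (j - k) \<or> 5 dvd (j - k - 1)" for j
      by (auto simp: clone_def)
    show ?thesis using xi unfolding k by presburger
  next
    fix k assume k: "\<forall>j. E x (c j) \<longleftrightarrow> \<not> 5 dvd (j - k)"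
    show ?thesis using xi unfolding k[rule_format] by presburger
  qed
  then show False
  proof (elim disjE conjE)
    assume a: "E x (c (i + 1))" "E x (c (i + 2))"
    have "diamond E (c i) x (c (i + 1)) (c (i + 2))" "diamond E (c (i + 2)) v (c (i + 3)) (c (i + 4))"
      using a xi x v(2) sym_iff[of "c (i + 2)" v] by (auto simp: diamond_def adj)
    moreover have "E (c (i + 4)) (c i)" by (simp add: adj)
    moreover have "distinct [c i, x, c (i + 1), c (i + 2), v, c (i + 3), c (i + 4)]"
      using xr v(1) xv hole_eq_iff[OF h] by auto
    ultimately show False by (rule no_moser)
  next
    assume a: "E x (c (i - 1))" "E x (c (i - 2))"
    have "diamond E (c i) x (c (i - 1)) (c (i - 2))" "diamond E (c (i - 2)) v (c (i - 3)) (c (i - 4))"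
      using a xi x v(2) sym_iff[of "c (i - 2)" v] by (auto simp: diamond_def adj)
    moreover have "E (c (i - 4)) (c i)" by (simp add: adj)
    moreover have "distinct [c i, x, c (i - 1), c (i - 2), v, c (i - 3), c (i - 4)]"
      using xr v(1) xv hole_eq_iff[OF h] by auto
    ultimately show False by (rule no_moser)
  next
    assume a: "E x (c (i - 1))" "E x (c (i + 1))"
    have "diamond E (c (i - 1)) x (c i) (c (i + 1))" "diamond E (c (i + 1)) v (c (i + 2)) (c (i + 3))"
      using a xi x v(2) sym_iff[of "c (i + 1)" v] sym_iff[of "c (i - 1)" x] by (auto simp: diamond_def adj)
    moreover have "E (c (i + 3)) (c (i - 1))" by (simp add: adj)
    moreover have "distinct [c (i - 1), x, c i, c (i + 1), v, c (i + 2), c (i + 3)]"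
      using xr v(1) xv hole_eq_iff[OF h] by auto
    ultimately show False by (rule no_moser)
  qed
qed

lemma hole_nbr_clone:
  assumes "hole E n c" "v \<notin> range c" "E v (c k)"
  obtains i where "clone n c i v"
  using hole_nbrs_cases[OF assms] hole_5_nbrs assms by metis


lemma twin_cong: "n dvd (i - j) \<Longrightarrow> twin n c i x \<longleftrightarrow> twin n c j x"
  unfolding twin_def using dvd_shift[of n i j _ 0] dvd_shift[of n i j _ 1] dvd_shift[of n i j _ "- 1"]
  by simp

lemma twin_nbrs:
  assumes h: "hole E n c" and "twin n c i x"
  shows "E x (c (i + 1))" "E x (c (i - 1))" "\<not> E x (c (i + 2))" "\<not> E x (c (i - 2))"
  using assms(2) hole_not_dvd_numeral[OF h] by (auto simp: twin_def)

lemma twin_in_V: "hole E n c \<Longrightarrow> twin n c i x \<Longrightarrow> x \<in> V"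
  using twin_nbrs E_in by blast

lemma twin_self:
  assumes "hole E n c"
  shows "twin n c i (c i)"
proof -
  have "n dvd (i - j - 1) \<longleftrightarrow> n dvd (j - i + 1)" "n dvd (i - j + 1) \<longleftrightarrow> n dvd (j - i - 1)" for j
    using dvd_minus_iff[of n "j - i + 1"] dvd_minus_iff[of n "j - i - 1"]
    by (simp_all add: algebra_simps)
  then show ?thesis unfolding twin_def hole_adj_iff[OF assms] by blast
qed

lemma twin_index_unique:
  assumes h: "hole E n c" and x: "twin n c i x" "twin n c j x"
  shows "n dvd (j - i)"
proof (rule ccontr)
  assume nd: "\<not> n dvd (j - i)"
  have "n dvd (j - i + 1) \<or> n dvd (j - i + 2)"
    using x(1)[unfolded twin_def, rule_format, of "j + 1"] twin_nbrs(1)[OF h x(2)] nd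
    by (auto simp: algebra_simps)
  moreover have "n dvd (j - i - 1) \<or> n dvd (j - i - 2)"
    using x(1)[unfolded twin_def, rule_format, of "j - 1"] twin_nbrs(2)[OF h x(2)] nd
    by (auto simp: algebra_simps)
  ultimately show False
    using hole_dvd_unique[OF h, of "j - i + 1" "j - i - 1"] hole_dvd_unique[OF h, of "j - i + 1" "j - i - 2"]
      hole_dvd_unique[OF h, of "j - i + 2" "j - i - 1"] hole_dvd_unique[OF h, of "j - i + 2" "j - i - 2"] by auto
qed

lemma twin_on_hole: "hole E n c \<Longrightarrow> twin n c i (c j) \<Longrightarrow> n dvd (j - i)"
  using twin_index_unique twin_self by blast

lemma hole_replace:
  assumes h: "hole E n c" and x: "twin n c i x"
  shows "hole E n (\<lambda>j. if n dvd (j - i) then x else c j)"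
proof -
  have xc: "x \<noteq> c j" if "\<not> n dvd (j - i)" for j
    using twin_on_hole[OF h] x that by blast
  have ax: "E x (c j) \<longleftrightarrow> n dvd (j - i - 1) \<or> n dvd (j - i + 1)" if "\<not> n dvd (j - i)" for j
    using x that by (auto simp: twin_def)
  have "(if n dvd (a - i) then x else c a) = (if n dvd (b - i) then x else c b) \<longleftrightarrow> n dvd (a - b)" for a b
  proof -
    have "n dvd (a - b)" if "n dvd (a - i)" "n dvd (b - i)"
      using dvd_diff[OF that] by simp
    moreover have "n dvd (a - i) \<longleftrightarrow> n dvd (b - i)" if "n dvd (a - b)"
      using dvd_shift[OF that, of "i" 0] dvd_minus_iff[of n "a - i"] dvd_minus_iff[of n "b - i"] by simp
    ultimately show ?thesis using xc[of a] xc[of b] hole_eq_iff[OF h, of a b] by auto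
  qed
  moreover have "E (if n dvd (a - i) then x else c a) (if n dvd (b - i) then x else c b) \<longleftrightarrow>
      n dvd (a - b - 1) \<or> n dvd (a - b + 1)" for a b
  proof -
    have neg: "n dvd (a - b - 1) \<longleftrightarrow> n dvd (b - a + 1)" "n dvd (a - b + 1) \<longleftrightarrow> n dvd (b - a - 1)"
      using dvd_minus_iff[of n "b - a + 1"] dvd_minus_iff[of n "b - a - 1"]
      by (simp_all add: algebra_simps)
    show ?thesis
    proof (cases "n dvd (a - i)"; cases "n dvd (b - i)")
      assume ab: "n dvd (a - i)" "n dvd (b - i)"
      then have "n dvd (a - b)" using dvd_diff[OF ab] by simp
      then have "\<not> n dvd (a - b - 1)" "\<not> n dvd (a - b + 1)"
        using hole_dvd_unique[OF h, of "a - b" "a - b - 1"] hole_dvd_unique[OF h, of "a - b" "a - b + 1"] by auto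
      then show ?thesis using ab irrefl by auto
    next
      assume ab: "n dvd (a - i)" "\<not> n dvd (b - i)"
      then show ?thesis
        using ax[OF ab(2)] neg dvd_shift[OF ab(1), of b 1] dvd_shift[OF ab(1), of b "- 1"] by auto
    next
      assume ab: "\<not> n dvd (a - i)" "n dvd (b - i)"
      then show ?thesis
        using ax[OF ab(1)] sym_iff[of "c a" x] dvd_shift[OF ab(2), of a 1] dvd_shift[OF ab(2), of a "- 1"]
        by auto
    next
      assume "\<not> n dvd (a - i)" "\<not> n dvd (b - i)"
      then show ?thesis by (simp add: hole_adj_iff[OF h])
    qed
  qed
  ultimately show ?thesis unfolding hole_def using hole_ge_5[OF h] hole_odd[OF h] by blast
qed

lemma ex_twin:
  assumes h: "hole E n c" and x: "x \<in> V"
  shows "\<exists>i. twin n c i x"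
proof -
  have "{x. \<exists>i. twin n c i x} = V"
  proof (rule connected_set)
    show "{x. \<exists>i. twin n c i x} \<subseteq> V" using twin_in_V[OF h] by blast
    show "{x. \<exists>i. twin n c i x} \<noteq> {}" using twin_self[OF h] by blast
    fix x y assume "x \<in> {x. \<exists>i. twin n c i x}" and xy: "E x y"
    then obtain i where i: "twin n c i x" by blast
    note t = twin_nbrs[OF h i]
    show "y \<in> {x. \<exists>i. twin n c i x}"
    proof (rule ccontr)
      assume nt: "y \<notin> {x. \<exists>i. twin n c i x}"
      then have yc: "y \<notin> range c" using twin_self[OF h] by blast
      have ny: "\<not> E y (c k)" for k
      proof
        assume "E y (c k)"
        then obtain l where "clone n c l y" by (rule hole_nbr_clone[OF h yc])
        then show False using clone_imp_twin nt by blast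
      qed
      have "\<not> E (c (i - 1)) (c (i + 1))" "E (c (i + 1)) (c (i + 2))" "\<not> E (c (i - 1)) (c (i + 2))"
        by (simp_all add: hole_adj_iff[OF h] hole_not_dvd_numeral[OF h])
      moreover have "y \<noteq> c (i - 1)" using yc by blast
      ultimately show False
        using no_chair[of x y "c (i - 1)" "c (i + 1)" "c (i + 2)"] t xy ny by blast
    qed
  qed
  then show ?thesis using x by blast
qed

lemma clone_index:
  assumes h: "hole E n c" and y: "clone n c k y" and j: "E y (c (j + 1))" "E y (c (j - 1))"
  shows "n dvd (k - j)"
proof (rule ccontr)
  assume nd: "\<not> n dvd (k - j)"
  then have nd': "\<not> n dvd (j - k)" using dvd_minus_iff[of n "j - k"] by simp
  have "n dvd (j - k + 2) \<or> n dvd (j - k + 1)" "n dvd (j - k - 1) \<or> n dvd (j - k - 2)"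
    using y[unfolded clone_def, rule_format, of "j + 1"] y[unfolded clone_def, rule_format, of "j - 1"] j nd'
    by (auto simp: algebra_simps)
  then show False
    using hole_dvd_unique[OF h, of "j - k + 1" "j - k - 1"] hole_dvd_unique[OF h, of "j - k + 1" "j - k - 2"]
      hole_dvd_unique[OF h, of "j - k + 2" "j - k - 1"] hole_dvd_unique[OF h, of "j - k + 2" "j - k - 2"] by auto
qed

lemma clone_cong: "n dvd (i - j) \<Longrightarrow> clone n c i x \<longleftrightarrow> clone n c j x"
  unfolding clone_def using dvd_shift[of n i j _ 0] dvd_shift[of n i j _ 1] dvd_shift[of n i j _ "- 1"]
  by simp

lemma twins_adjacent:
  assumes h: "hole E n c" and x: "twin n c i x" and y: "twin n c i y" and "x \<noteq> y"
  shows "E x y"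
proof -
  define c' where "c' j = (if n dvd (j - i) then x else c j)" for j
  have h': "hole E n c'" using hole_replace[OF h x] unfolding c'_def .
  have e: "c' (i + 1) = c (i + 1)" "c' (i - 1) = c (i - 1)" "c' i = x"
    using hole_not_dvd_numeral[OF h] by (auto simp: c'_def)
  have yr: "y \<notin> range c'"
    using twin_on_hole[OF h] y \<open>x \<noteq> y\<close> by (auto simp: c'_def split: if_splits)
  have a: "E y (c' (i + 1))" "E y (c' (i - 1))" using e twin_nbrs[OF h y] by auto
  obtain k where k: "clone n c' k y" using hole_nbr_clone[OF h' yr a(1)] by blast
  then have "clone n c' i y" using clone_index[OF h' k a] clone_cong by blast
  then have "E y (c' i)" by (auto simp: clone_def)
  then show ?thesis using e sym by simp
qed

lemma twin_adj:
  assumes h: "hole E n c" and x: "twin n c i x" and y: "twin n c j y" and ij: "\<not> n dvd (j - i)"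
  shows "E x y \<longleftrightarrow> n dvd (j - i - 1) \<or> n dvd (j - i + 1)"
proof (cases "y \<in> range c")
  case True
  then obtain l where "y = c l" by blast
  then have "y = c j" using twin_on_hole[OF h] y hole_eq_iff[OF h] by blast
  then show ?thesis using x ij by (auto simp: twin_def)
next
  case False
  define c' where "c' j = (if n dvd (j - i) then x else c j)" for j
  have h': "hole E n c'" using hole_replace[OF h x] unfolding c'_def .
  have "x \<noteq> y" using twin_index_unique[OF h] x y ij by blast
  then have yr: "y \<notin> range c'" using False by (auto simp: c'_def)
  have e: "c' i = x" "\<And>l. \<not> n dvd (l - i) \<Longrightarrow> c' l = c l" by (auto simp: c'_def)
  note t = twin_nbrs[OF h y]
  have "\<exists>k. clone n c' k y \<and> n dvd (k - j)"
  proof -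
    consider (up) "n dvd (j - i + 1)" | (down) "n dvd (j - i - 1)" | (far) "\<not> n dvd (j - i + 1)" "\<not> n dvd (j - i - 1)"
      by blast
    then show ?thesis
    proof cases
      case up
      have "c' (j - 1) = c (j - 1)" "c' (j - 2) = c (j - 2)"
        using e(2)[of "j - 1"] e(2)[of "j - 2"] hole_dvd_unique[OF h up, of "j - i - 1"]
          hole_dvd_unique[OF h up, of "j - i - 2"] by (auto simp: algebra_simps)
      then have a: "E y (c' (j - 1))" "\<not> E y (c' (j - 2))" using t by simp_all
      obtain k where k: "clone n c' k y" using hole_nbr_clone[OF h' yr a(1)] by blast
      have "n dvd (j - k)"
        using k[unfolded clone_def, rule_format, of "j - 1"] k[unfolded clone_def, rule_format, of "j - 2"] a
        by (auto simp: algebra_simps)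
      then show ?thesis using k dvd_minus_iff[of n "j - k"] by auto
    next
      case down
      have "c' (j + 1) = c (j + 1)" "c' (j + 2) = c (j + 2)"
        using e(2)[of "j + 1"] e(2)[of "j + 2"] hole_dvd_unique[OF h down, of "j - i + 1"]
          hole_dvd_unique[OF h down, of "j - i + 2"] by (auto simp: algebra_simps)
      then have a: "E y (c' (j + 1))" "\<not> E y (c' (j + 2))" using t by simp_all
      obtain k where k: "clone n c' k y" using hole_nbr_clone[OF h' yr a(1)] by blast
      have "n dvd (j - k)"
        using k[unfolded clone_def, rule_format, of "j + 1"] k[unfolded clone_def, rule_format, of "j + 2"] a
        by (auto simp: algebra_simps)
      then show ?thesis using k dvd_minus_iff[of n "j - k"] by auto
    next
      case far
      have "c' (j + 1) = c (j + 1)" "c' (j - 1) = c (j - 1)"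
        using e(2)[of "j + 1"] e(2)[of "j - 1"] far by (auto simp: algebra_simps)
      then have a: "E y (c' (j + 1))" "E y (c' (j - 1))" using t by simp_all
      obtain k where k: "clone n c' k y" using hole_nbr_clone[OF h' yr a(1)] by blast
      then show ?thesis using clone_index[OF h' k a] by blast
    qed
  qed
  then have "clone n c' j y" using clone_cong by blast
  then have "E y x \<longleftrightarrow> n dvd (i - j + 1) \<or> n dvd (i - j) \<or> n dvd (i - j - 1)"
    using e(1) by (auto simp: clone_def)
  moreover have "n dvd (i - j + 1) \<longleftrightarrow> n dvd (j - i - 1)" "n dvd (i - j) \<longleftrightarrow> n dvd (j - i)"
    "n dvd (i - j - 1) \<longleftrightarrow> n dvd (j - i + 1)"
    using dvd_minus_iff[of n "j - i - 1"] dvd_minus_iff[of n "j - i"] dvd_minus_iff[of n "j - i + 1"]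
    by (simp_all add: algebra_simps)
  ultimately show ?thesis using ij sym_iff[of x y] by blast
qed

definition doubled :: "int \<Rightarrow> (int \<Rightarrow> 'a) \<Rightarrow> int \<Rightarrow> bool" where
  "doubled n c i \<longleftrightarrow> (\<exists>x. twin n c i x \<and> x \<noteq> c i)"

lemma doubled_not_consecutive:
  assumes h: "hole E n c" and "doubled n c i" "doubled n c (i + 1)"
  shows False
proof -
  obtain x y where x: "twin n c i x" "x \<noteq> c i" and y: "twin n c (i + 1) y" "y \<noteq> c (i + 1)"
    using assms by (auto simp: doubled_def)
  note s = twin_self[OF h]
  have "E a b" if "twin n c i a" "twin n c (i + 1) b" for a b
    using twin_adj[OF h that] hole_not_dvd_numeral[OF h] by simp
  moreover have "E (c i) x" "E (c (i + 1)) y" using twins_adjacent[OF h] s x y by metis+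
  ultimately show False using no_K4[of "c i" x "c (i + 1)" y] s x y by blast
qed

lemma twin_eq_hole_vertex:
  assumes h: "hole E n c" and x: "twin n c i x" and y: "twin n c i y" and "x \<noteq> y"
  shows "x = c i \<or> y = c i"
proof (rule ccontr)
  assume a: "\<not> ?thesis"
  note s = twin_self[OF h, of i]
  have "E x y" "E x (c i)" "E y (c i)" using twins_adjacent[OF h] s x y a \<open>x \<noteq> y\<close> by metis+
  moreover have "E x (c (i + 1))" "E y (c (i + 1))" "E (c i) (c (i + 1))"
    using twin_nbrs(1)[OF h] x y s by blast+
  ultimately show False using no_K4[of x y "c i" "c (i + 1)"] by blast
qed

lemma one_simple_seam_False:
  assumes h: "hole E n c" and seam: "\<not> doubled n c (- 1)" "\<not> doubled n c 0"
    and tight: "\<And>j. 0 \<le> j \<Longrightarrow> j < n - 1 \<Longrightarrow> doubled n c j \<or> doubled n c (j + 1)"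
  shows False
proof -
  have dbl: "int k < n \<Longrightarrow> doubled n c (int k) \<longleftrightarrow> odd k" for k
  proof (induction k)
    case (Suc k)
    then show ?case
      using tight[of "int k"] doubled_not_consecutive[OF h, of "int k"] by (auto simp: add.commute)
  qed (use seam in simp)
  define p where "p = nat (n div 2)"
  have p: "n = 2 * int p + 1" "p \<ge> 2" using hole_ge_5[OF h] hole_odd[OF h] by (auto simp: p_def)
  have "\<exists>x. twin n c (2 * int i + 1) x \<and> x \<noteq> c (2 * int i + 1)" if "i < p" for i
    using dbl[of "2 * i + 1"] that p by (auto simp: doubled_def add.commute)
  then obtain e where e: "\<And>i. i < p \<Longrightarrow> twin n c (2 * int i + 1) (e i) \<and> e i \<noteq> c (2 * int i + 1)"
    by metis
  define u where "u k = (if k mod 3 = 0 then c (2 * int (k div 3)) else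
    if k mod 3 = 1 then c (2 * int (k div 3) + 1) else e (k div 3))" for k
  define idx where "idx k = 2 * int (k div 3) + (if k mod 3 = 0 then 0 else 1)" for k
  have kd: "k div 3 \<le> p" "k mod 3 \<noteq> 0 \<Longrightarrow> k div 3 < p" if "k \<le> 3 * p" for k
    using that by presburger+
  have m3: "k mod 3 = 0 \<or> k mod 3 = 1 \<or> k mod 3 = 2" for k :: nat
    by presburger
  have par: "A = B \<and> (P \<longleftrightarrow> Q)"
    if "2 * A + (if P then 0 else 1) = 2 * B + (if Q then 0 else (1::int))" for A B P Q
    using that by (cases P; cases Q; simp; presburger)
  have if_inj: "P \<longleftrightarrow> Q" if "(if P then x else y) = (if Q then x else y)" "x \<noteq> y" for P Q and x y :: 'a
    using that by (auto split: if_splits)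
  have tw: "twin n c (idx k) (u k)" if "k \<le> 3 * p" for k
  proof -
    show ?thesis using kd(2)[OF that] e[of "k div 3"] twin_self[OF h] by (auto simp: u_def idx_def)
  qed
  have idx_range: "0 \<le> idx k" "idx k < n" if "k \<le> 3 * p" for k
    using kd[OF that] p by (auto simp: idx_def)
  have inj: "inj_on u {0..3 * p}"
  proof (rule inj_onI)
    fix a b assume ab: "a \<in> {0..3 * p}" "b \<in> {0..3 * p}" "u a = u b"
    then have "twin n c (idx a) (u a)" "twin n c (idx b) (u a)" using tw[of a] tw[of b] by simp_all
    then have "n dvd (idx a - idx b)" using twin_index_unique[OF h] by blast
    moreover have "\<bar>idx a - idx b\<bar> < n" using idx_range[of a] idx_range[of b] ab(1,2) by auto
    ultimately have eq: "idx a = idx b"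
      using dvd_imp_le_int[of "idx a - idx b" n] by linarith
    then have d: "a div 3 = b div 3" "a mod 3 = 0 \<longleftrightarrow> b mod 3 = 0"
      using par[OF eq[unfolded idx_def]] by simp_all
    have "a mod 3 = b mod 3"
    proof (cases "a mod 3 = 0")
      case False
      have lt: "a div 3 < p" using False ab(1) kd(2)[of a] by simp
      have nz: "a mod 3 \<noteq> 0" "b mod 3 \<noteq> 0" using False d(2) by metis+
      have ua: "u a = (if a mod 3 = 1 then c (2 * int (b div 3) + 1) else e (b div 3))"
        by (simp only: u_def nz(1) if_False d(1))
      have ub: "u b = (if b mod 3 = 1 then c (2 * int (b div 3) + 1) else e (b div 3))"
        by (simp only: u_def nz(2) if_False)
      have "c (2 * int (b div 3) + 1) \<noteq> e (b div 3)" using e[OF lt] unfolding d(1) by metis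
      then have "a mod 3 = 1 \<longleftrightarrow> b mod 3 = 1" using ab(3) if_inj unfolding ua ub by metis
      then show ?thesis using nz m3[of a] m3[of b] by metis
    next
      case True
      then show ?thesis using d(2) by metis
    qed
    then show "a = b" using d(1) div_mult_mod_eq[of a 3] div_mult_mod_eq[of b 3] by linarith
  qed
  have dia: "diamond E (u (3 * i)) (u (3 * i + 1)) (u (3 * i + 2)) (u (3 * i + 3))" if "i < p" for i
  proof -
    have u: "u (3 * i) = c (2 * int i)" "u (3 * i + 1) = c (2 * int i + 1)" "u (3 * i + 2) = e i"
      "u (3 * i + 3) = c (2 * int i + 2)"
    proof -
      have "(3 * i + 1) div 3 = i" "(3 * i + 1) mod 3 = 1" "(3 * i + 2) div 3 = i" "(3 * i + 2) mod 3 = 2"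
        "(3 * i + 3) div 3 = i + 1" "(3 * i + 3) mod 3 = 0"  by presburger+
      then show "u (3 * i) = c (2 * int i)" "u (3 * i + 1) = c (2 * int i + 1)" "u (3 * i + 2) = e i"
      "u (3 * i + 3) = c (2 * int i + 2)" by (simp_all add: u_def add.commute)
    qed
    have t: "twin n c (2 * int i + 1) (e i)" "e i \<noteq> c (2 * int i + 1)" using e[OF that] by auto
    have "E (c (2 * int i + 1)) (e i)" using twins_adjacent[OF h twin_self[OF h] t(1)] t(2) by metis
    moreover have "E (e i) (c (2 * int i + 2))" "E (e i) (c (2 * int i))"
      using twin_nbrs(1,2)[OF h t(1)] by (simp_all add: add.commute)
    moreover then have "E (c (2 * int i)) (e i)" using sym by blast
    ultimately show ?thesis unfolding diamond_def u by (simp add: hole_adj_iff[OF h])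
  qed
  have "E (u (3 * p)) (u 0)"
    using p(1) by (simp add: u_def hole_adj_iff[OF h])
  then show False using no_spindle[OF _ inj dia] p(2) by simp
qed

text \<open>Colour undoubled vertices by the number \<open>K\<close> of simple edges passed since the seam at \<open>0\<close>:
  colour \<open>0\<close> before the first one, then alternately \<open>2\<close> and \<open>1\<close>. As \<open>0\<close> never recurs, the seam
  itself is properly coloured whatever the parity.\<close>

lemma two_simple_seams_False:
  assumes h: "hole E n c" and seam: "\<not> doubled n c (- 1)" "\<not> doubled n c 0"
    and loose: "0 \<le> j" "j < n - 1" "\<not> doubled n c j" "\<not> doubled n c (j + 1)"
  shows False
proof -
  define K :: "nat \<Rightarrow> nat" where "K m = (\<Sum>l<m. of_bool (\<not> doubled n c (int l) \<and> \<not> doubled n c (int l + 1)))" for m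
  define \<kappa> where "\<kappa> m = (if K m = 0 then 0 else 1 + K m mod 2)" for m
  have K3: "\<kappa> m < 3" for m
    using mod_less_divisor[of 2 "K m"] unfolding \<kappa>_def by (auto simp del: mod_less_divisor)
  have np: "n > 0" using hole_ge_5[OF h] by linarith
  define N where "N = nat n"
  have N: "int N = n" using np by (simp add: N_def)
  have "\<exists>i<N. twin n c (int i) x" if xV: "x \<in> V" for x
  proof -
    obtain i where "twin n c i x" using ex_twin[OF h xV] by blast
    moreover have "n dvd (i - i mod n)" by (rule dvd_minus_mod)
    ultimately have "twin n c (i mod n) x" using twin_cong by blast
    moreover have "0 \<le> i mod n" "i mod n < n" using np by simp_all
    ultimately show ?thesis by (intro exI[of _ "nat (i mod n)"]) (auto simp: N_def)
  qed
  then obtain idx where idx: "\<And>x. x \<in> V \<Longrightarrow> idx x < N \<and> twin n c (int (idx x)) x" by metis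
  define col where "col x = (let i = idx x in if \<not> doubled n c (int i) then \<kappa> i
     else if x = c (int i) then (\<kappa> i + 1) mod 3 else (\<kappa> i + 2) mod 3)" for x
  have col3: "col x < 3" for x using K3 by (auto simp: col_def Let_def)
  have mods: "k < 3 \<Longrightarrow> (k + 1) mod 3 \<noteq> k" "k < 3 \<Longrightarrow> (k + 2) mod 3 \<noteq> k" "(k + 1) mod 3 \<noteq> (k + 2) mod 3" for k :: nat
    by presburger+
  have neq: "col x \<noteq> col y" if xy: "E x y" "idx x \<le> idx y" for x y
  proof -
    have V: "x \<in> V" "y \<in> V" using xy E_in by blast+
    let ?i = "idx x" and ?j = "idx y"
    have ti: "twin n c (int ?i) x" "int ?i < n" and tj: "twin n c (int ?j) y" "int ?j < n"
      using idx V N by auto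
    show ?thesis
    proof (cases "?i = ?j")
      case True
      have "x \<noteq> y" using xy irrefl by blast
      moreover have "x = c (int ?i) \<or> y = c (int ?i)"
        using twin_eq_hole_vertex[OF h ti(1), of y] tj True \<open>x \<noteq> y\<close> by auto
      moreover have "doubled n c (int ?i)"
        using ti tj True calculation by (auto simp: doubled_def)
      ultimately show ?thesis using True mods(3) mods(3)[symmetric] by (auto simp: col_def Let_def)
    next
      case False
      then have lt: "?i < ?j" using xy by auto
      have "\<not> n dvd (int ?j - int ?i)" using lt tj zdvd_imp_le[of n "int ?j - int ?i"] by auto
      then have "n dvd (int ?j - int ?i - 1) \<or> n dvd (int ?j - int ?i + 1)"
        using twin_adj[OF h ti(1) tj(1)] xy by blast
      then have "?j = ?i + 1 \<or> ?i = 0 \<and> int ?j = n - 1"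
      proof
        assume a: "n dvd (int ?j - int ?i - 1)"
        show ?thesis using zdvd_imp_le[OF a] lt tj by (cases "?j = ?i + 1") auto
      next
        assume a: "n dvd (int ?j - int ?i + 1)"
        show ?thesis using zdvd_imp_le[OF a] lt tj by auto
      qed
      then show ?thesis
      proof (elim disjE conjE)
        assume j: "?j = ?i + 1"
        have KS: "K ?j = K ?i + of_bool (\<not> doubled n c (int ?i) \<and> \<not> doubled n c (int ?j))"
          using j by (simp add: K_def add.commute)
        consider (none) "\<not> doubled n c (int ?i)" "\<not> doubled n c (int ?j)"
          | (l) "doubled n c (int ?i)" "\<not> doubled n c (int ?j)"
          | (r) "\<not> doubled n c (int ?i)" "doubled n c (int ?j)"
          using doubled_not_consecutive[OF h, of "int ?i"] j by (auto simp: add.commute)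
        then show ?thesis
        proof cases
          case none
          then have "K ?j = K ?i + 1" using KS by simp
          then have "\<kappa> ?i \<noteq> \<kappa> ?j" unfolding \<kappa>_def by (simp; presburger)
          then show ?thesis using none by (simp add: col_def)
        next
          case l
          then have "\<kappa> ?j = \<kappa> ?i" using KS by (simp add: \<kappa>_def)
          then show ?thesis using l mods(1,2)[OF K3] by (simp add: col_def Let_def)
        next
          case r
          then have "\<kappa> ?j = \<kappa> ?i" using KS by (simp add: \<kappa>_def)
          then show ?thesis using r mods(1,2)[OF K3[of ?i]] by (simp add: col_def Let_def)
        qed
      next
        assume i: "?i = 0" and j: "int ?j = n - 1"
        have "n dvd (int ?j - (- 1))" using j by simp
        then have "twin n c (int ?j) = twin n c (- 1)" "c (int ?j) = c (- 1)"
          using twin_cong hole_eq_iff[OF h] by blast+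
        then have "\<not> doubled n c (int ?j)" using seam by (simp add: doubled_def)
        moreover have "K ?j \<noteq> 0"
        proof -
          have "nat j < ?j" "int (nat j) = j" using \<open>int ?j = n - 1\<close> loose by auto
          then show ?thesis using loose(3,4) by (auto simp: K_def)
        qed
        moreover have "K ?i = 0" using i by (simp add: K_def)
        ultimately show ?thesis using seam i by (simp add: col_def \<kappa>_def)
      qed
    qed
  qed
  have "proper3 E V col"
  proof (rule proper3I)
    show "col x \<noteq> col y" if "E x y" for x y
      using neq[of x y] neq[of y x] that sym[of x y] by (cases "idx x \<le> idx y") auto
  qed (rule col3)
  then show False using not_colourable by blast
qed

lemma no_hole: "\<not> hole E n c"
proof
  assume h: "hole E n c"
  have per: "doubled n c i = doubled n c j" if "n dvd (i - j)" for i j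
    using that twin_cong[OF that] hole_eq_iff[OF h, of i j] by (simp add: doubled_def)
  have "\<exists>i. \<not> doubled n c i \<and> \<not> doubled n c (i + 1)"
  proof (rule ccontr)
    assume "\<not> ?thesis"
    then have alt: "doubled n c (i + 1) \<longleftrightarrow> \<not> doubled n c i" for i
      using doubled_not_consecutive[OF h] by blast
    have "doubled n c (int k) \<longleftrightarrow> (doubled n c 0 \<longleftrightarrow> even k)" for k
    proof (induction k)
      case (Suc k)
      then show ?case using alt[of "int k"] by (auto simp: add.commute)
    qed simp
    from this[of "nat n"] show False
      using per[of n 0] hole_ge_5[OF h] hole_odd[OF h] by (auto simp: even_nat_iff)
  qed
  then obtain i where i: "\<not> doubled n c i" "\<not> doubled n c (i + 1)" by blast
  define d where "d j = c (j + (i + 1))" for j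
  have hd: "hole E n d" unfolding d_def by (rule hole_shift[OF h])
  have "twin n d j x \<longleftrightarrow> twin n c (j + (i + 1)) x" for j x
  proof
    assume a: "twin n d j x"
    show "twin n c (j + (i + 1)) x" unfolding twin_def
    proof (intro allI)
      fix l
      show "\<not> n dvd (l - (j + (i + 1))) \<longrightarrow> (E x (c l) \<longleftrightarrow> n dvd (l - (j + (i + 1)) - 1) \<or> n dvd (l - (j + (i + 1)) + 1))"
        using a[unfolded twin_def, rule_format, of "l - (i + 1)"] by (simp add: d_def algebra_simps)
    qed
  next
    assume a: "twin n c (j + (i + 1)) x"
    show "twin n d j x" unfolding twin_def
    proof (intro allI)
      fix l
      show "\<not> n dvd (l - j) \<longrightarrow> (E x (d l) \<longleftrightarrow> n dvd (l - j - 1) \<or> n dvd (l - j + 1))"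
        using a[unfolded twin_def, rule_format, of "l + (i + 1)"] by (simp add: d_def)
    qed
  qed
  then have "doubled n d j \<longleftrightarrow> doubled n c (j + (i + 1))" for j
    by (simp add: doubled_def d_def)
  then have "\<not> doubled n d (- 1)" "\<not> doubled n d 0" using i by simp_all
  then show False using one_simple_seam_False[OF hd] two_simple_seams_False[OF hd] by blast
qed

section \<open>Neighbourhoods in the absence of odd holes\<close>

lemma hole_of_cycle:
  assumes N: "odd N" "N \<ge> 5" and inj: "inj_on g {..<N}"
    and adj: "\<And>a b. a < b \<Longrightarrow> b < N \<Longrightarrow> E (g a) (g b) \<longleftrightarrow> b = a + 1 \<or> a = 0 \<and> b = N - 1"
  shows "hole E (int N) (\<lambda>i. g (nat (i mod int N)))"
proof -
  let ?n = "int N"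
  have n: "?n > 0" using N by auto
  have r: "0 \<le> i mod ?n" "i mod ?n < ?n" for i using n by simp_all
  have eq: "g (nat (i mod ?n)) = g (nat (j mod ?n)) \<longleftrightarrow> ?n dvd (i - j)" for i j
  proof -
    have "nat (i mod ?n) < N" "nat (j mod ?n) < N" using r[of i] r[of j] by linarith+
    then have "g (nat (i mod ?n)) = g (nat (j mod ?n)) \<longleftrightarrow> nat (i mod ?n) = nat (j mod ?n)"
      using inj by (auto dest: inj_onD)
    also have "\<dots> \<longleftrightarrow> i mod ?n = j mod ?n" by (rule eq_nat_nat_iff[OF r(1) r(1)])
    finally show ?thesis by (simp add: mod_eq_dvd_iff)
  qed
  have d1: "?n dvd (i - j - 1) \<longleftrightarrow> i mod ?n = (if j mod ?n = ?n - 1 then 0 else j mod ?n + 1)" for i j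
    using int_mod_succ[OF n, of j] mod_eq_dvd_iff[of i ?n "j + 1"] by (simp add: algebra_simps)
  have d2: "?n dvd (i - j + 1) \<longleftrightarrow> j mod ?n = (if i mod ?n = ?n - 1 then 0 else i mod ?n + 1)" for i j
    using int_mod_succ[OF n, of i] mod_eq_dvd_iff[of "i + 1" ?n j] by (simp add: algebra_simps eq_commute)
  have "E (g a) (g b) \<longleftrightarrow> int a = (if int b = ?n - 1 then 0 else int b + 1) \<or> int b = (if int a = ?n - 1 then 0 else int a + 1)"
    if "a < N" "b < N" for a b
  proof (cases a b rule: linorder_cases)
    case less
    then show ?thesis using adj[OF less] that N by auto
  next
    case equal
    then show ?thesis using irrefl N that by auto
  next
    case greater
    then show ?thesis using adj[OF greater] sym_iff[of "g a" "g b"] that N by auto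
  qed
  note E' = this
  have "E (g (nat (i mod ?n))) (g (nat (j mod ?n))) \<longleftrightarrow> ?n dvd (i - j - 1) \<or> ?n dvd (i - j + 1)" for i j
  proof -
    have "nat (i mod ?n) < N" "nat (j mod ?n) < N" using r[of i] r[of j] by linarith+
    from E'[OF this] show ?thesis unfolding d1 d2 using r[of i] r[of j] by simp
  qed
  then show ?thesis unfolding hole_def using eq N by auto
qed

lemma proper3_neq:
  "\<lbrakk>proper3 E (V - {v}) f; E x y; x \<noteq> v; y \<noteq> v\<rbrakk> \<Longrightarrow> f x \<noteq> f y"
  using E_in by (auto simp: proper3_def)

text \<open>Otherwise a shortest two-coloured Kempe chain between neighbours of the uncoloured vertex
  closes up to an odd hole.\<close>

lemma edge_of_colours:
  assumes v: "v \<in> V" and f: "proper3 E (V - {v}) f" and ij: "i < 3" "j < 3" "i \<noteq> j"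
  shows "\<exists>a b. E v a \<and> E v b \<and> E a b \<and> f a = i \<and> f b = j"
proof -
  define walk where "walk p m \<longleftrightarrow> E v (p 0) \<and> f (p 0) = i \<and>
     (\<forall>k\<le>m. p k \<in> V - {v} \<and> (f (p k) = i \<or> f (p k) = j)) \<and> (\<forall>k<m. E (p k) (p (Suc k)))" for p and m :: nat
  define R where "R = {y. \<exists>p m. walk p m \<and> p m = y}"
  have R_start: "y \<in> R" if "E v y" "f y = i" for y
  proof -
    have "y \<in> V - {v}" using that E_in irrefl by blast
    then have "walk (\<lambda>_. y) 0" using that by (auto simp: walk_def)
    then show ?thesis by (auto simp: R_def)
  qed
  have R_step: "z \<in> R" if "y \<in> R" "E y z" "z \<noteq> v" "f z = i \<or> f z = j" for y z
  proof -
    obtain p m where p: "walk p m" "p m = y" using \<open>y \<in> R\<close> by (auto simp: R_def)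
    have "z \<in> V" using that E_in by blast
    then have "walk (p(Suc m := z)) (Suc m)"
      using p that by (auto simp: walk_def le_Suc_eq less_Suc_eq)
    then show ?thesis unfolding R_def by fastforce
  qed
  have R_col: "y \<in> V - {v}" "f y = i \<or> f y = j" if "y \<in> R" for y
    using that by (auto simp: R_def walk_def)
  have "\<exists>y\<in>R. E v y \<and> f y = j"
  proof (rule ccontr)
    assume none: "\<not> ?thesis"
    define g where "g x = (if x = v then i else if x \<in> R then (if f x = i then j else i) else f x)" for x
    have "proper3 E V g"
    proof (rule proper3I)
      show "g x < 3" if "x \<in> V" for x
        using that f ij by (auto simp: g_def proper3_def)
      have v_ok: "g y \<noteq> i" if "E v y" for y
        using that none R_col[of y] R_start[of y] ij irrefl by (auto simp: g_def)
      show "g x \<noteq> g y" if "x \<in> V" "y \<in> V" "E x y" for x y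
      proof (cases "x = v \<or> y = v")
        case True
        moreover have "g v = i" by (simp add: g_def)
        ultimately show ?thesis using v_ok[of x] v_ok[of y] that sym[of x y] by metis
      next
        case False
        then have "f x \<noteq> f y" using proper3_neq[OF f \<open>E x y\<close>] by blast
        then show ?thesis
          using False R_step[of x y] R_step[of y x] R_col[of x] R_col[of y] that sym[of x y] ij
          by (auto simp: g_def)
      qed
    qed
    then show False using not_colourable by blast
  qed
  then have ex: "\<exists>m p. walk p m \<and> E v (p m) \<and> f (p m) = j" by (auto simp: R_def)
  define m where "m = (LEAST m. \<exists>p. walk p m \<and> E v (p m) \<and> f (p m) = j)"
  obtain p where p: "walk p m" "E v (p m)" "f (p m) = j"
    using LeastI_ex[OF ex] unfolding m_def by blast
  have least: "m \<le> l" if "walk q l" "E v (q l)" "f (q l) = j" for q l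
    using Least_le[of "\<lambda>m. \<exists>p. walk p m \<and> E v (p m) \<and> f (p m) = j" l] that unfolding m_def by blast
  have pE: "E (p k) (p (Suc k))" if "k < m" for k using p that by (auto simp: walk_def)
  have pV: "p k \<in> V" "p k \<noteq> v" "f (p k) = i \<or> f (p k) = j" if "k \<le> m" for k
    using p that by (auto simp: walk_def)
  have alt: "f (p k) = (if even k then i else j)" if "k \<le> m" for k
    using that
  proof (induction k)
    case 0
    then show ?case using p by (auto simp: walk_def)
  next
    case (Suc k)
    then have "f (p k) \<noteq> f (p (Suc k))" using proper3_neq[OF f] pE[of k] pV[of k] pV[of "Suc k"] by auto
    then show ?case using Suc pV(3)[of "Suc k"] by auto
  qed
  have "odd m" using alt[of m] p ij by (auto split: if_splits)
  have chord: "b = a + 1" if "E (p a) (p b)" "a < b" "b \<le> m" for a b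
  proof (rule ccontr)
    assume "b \<noteq> a + 1"
    define d where "d = b - a - 1"
    define q where "q k = (if k \<le> a then p k else p (k + d))" for k
    have "walk q (m - d)"
      unfolding walk_def
    proof (intro conjI allI impI)
      show "E v (q 0)" "f (q 0) = i" using p by (auto simp: q_def walk_def)
      fix k assume "k \<le> m - d"
      then have "k \<le> a \<Longrightarrow> k \<le> m" "\<not> k \<le> a \<Longrightarrow> k + d \<le> m" using that by (auto simp: d_def)
      then show "q k \<in> V - {v}" "f (q k) = i \<or> f (q k) = j" using pV by (auto simp: q_def)
    next
      fix k assume "k < m - d"
      consider "k < a" | "k = a" | "k > a" by linarith
      then show "E (q k) (q (Suc k))"
      proof cases
        case 1
        then show ?thesis using pE[of k] that by (auto simp: q_def)
      next
        case 2
        then have "Suc k + d = b" using that by (auto simp: d_def)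
        then show ?thesis using 2 that by (auto simp: q_def simp del: add_Suc)
      next
        case 3
        then show ?thesis using pE[of "k + d"] \<open>k < m - d\<close> by (auto simp: q_def)
      qed
    qed
    moreover have "q (m - d) = p m" using that by (auto simp: q_def d_def)
    ultimately have "m \<le> m - d" using least p by metis
    then show False using that \<open>b \<noteq> a + 1\<close> by (auto simp: d_def)
  qed
  have vend: "a = 0 \<or> a = m" if "E v (p a)" "a \<le> m" for a
  proof (cases "even a")
    case True
    have "walk (\<lambda>k. p (k + a)) (m - a)"
      using that pE pV alt[of a] True by (auto simp: walk_def)
    then have "m \<le> m - a" using least[of "\<lambda>k. p (k + a)" "m - a"] p that by auto
    then show ?thesis using that by auto
  next
    case False
    have "walk p a" using p(1) that by (auto simp: walk_def)
    then have "m \<le> a" using least[of p a] that alt[of a] False by auto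
    then show ?thesis using that by auto
  qed
  show ?thesis
  proof (cases "m = 1")
    case True
    then show ?thesis using p pE[of 0] by (auto simp: walk_def)
  next
    case False
    then have m3: "m \<ge> 3" using \<open>odd m\<close> by presburger
    define g where "g k = (if k = m + 1 then v else p k)" for k
    have neq: "p a \<noteq> p b" if "a < b" "b \<le> m" for a b
    proof
      assume eq: "p a = p b"
      show False
      proof (cases "b = m")
        case True
        then have "E v (p a)" using eq p by simp
        then have "a = 0" using vend that by fastforce
        then show False using eq True p ij by (auto simp: walk_def)
      next
        case False
        then have "E (p a) (p (Suc b))" using pE[of b] eq that by auto
        then show False using chord[of a "Suc b"] that False by auto
      qed
    qed
    have inj: "inj_on g {..<m + 2}"
    proof (rule linorder_inj_onI)
      fix a b assume "a < b" "a \<in> {..<m + 2}" "b \<in> {..<m + 2}"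
      then show "g a \<noteq> g b" using neq[of a b] pV[of a] by (auto simp: g_def)
    qed auto
    have "hole E (int (m + 2)) (\<lambda>k. g (nat (k mod int (m + 2))))"
    proof (rule hole_of_cycle[OF _ _ inj])
      fix a b assume ab: "a < b" "b < m + 2"
      show "E (g a) (g b) \<longleftrightarrow> b = a + 1 \<or> a = 0 \<and> b = m + 2 - 1"
      proof (cases "b = m + 1")
        case True
        then show ?thesis using ab vend[of a] sym_iff[of "p a" v] p by (auto simp: g_def walk_def)
      next
        case False
        then show ?thesis using ab chord[of a b] pE[of a] by (auto simp: g_def)
      qed
    qed (use \<open>odd m\<close> m3 in auto)
    then show ?thesis using no_hole by blast
  qed
qed

lemma nbr_of_colour:
  assumes "v \<in> V" "proper3 E (V - {v}) f" "i < 3"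
  shows "\<exists>a. E v a \<and> f a = i"
proof -
  obtain j :: nat where "j < 3" "j \<noteq> i" 
    using that[of 0] that[of 1] by (cases "i = 0") auto
  then show ?thesis using edge_of_colours[OF assms] by blast
qed

lemma proper3_less:
  "\<lbrakk>proper3 E (V - {v}) f; x \<in> V; x \<noteq> v\<rbrakk> \<Longrightarrow> f x < 3"
  by (auto simp: proper3_def)

lemma other_colours:
  assumes "(a::nat) < 3"
  obtains b c where "b < 3" "c < 3" "b \<noteq> c" "a \<noteq> b" "a \<noteq> c" "\<forall>k<3. k = a \<or> k = b \<or> k = c"
proof -
  consider "a = 0" | "a = 1" | "a = 2" using assms by linarith
  then show ?thesis
  proof cases
    case 1 then show ?thesis by (intro that[of 1 2]) auto
  next
    case 2 then show ?thesis by (intro that[of 0 2]) auto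
  next
    case 3 then show ?thesis by (intro that[of 0 1]) auto
  qed
qed

text \<open>In a colouring that omits \<open>y1\<close>, a neighbour of \<open>y1\<close> coloured like \<open>y2\<close> and \<open>y3\<close> creates a chair.\<close>

lemma common_nbrs_le_2:
  assumes "E v x" "E v y1" "E v y2" "E v y3" "E x y1" "E x y2" "E x y3" "y1 \<noteq> y2" "y1 \<noteq> y3" "y2 \<noteq> y3"
  shows False
proof -
  have "y1 \<in> V" using assms E_in by blast
  then obtain f where f: "proper3 E (V - {y1}) f" using critical by blast
  have less: "f v < 3" "f x < 3" "f y2 < 3" "f y3 < 3"
    using assms E_in irrefl by (auto intro!: proper3_less[OF f])
  have neq: "f v \<noteq> f x" "f v \<noteq> f y2" "f v \<noteq> f y3" "f x \<noteq> f y2" "f x \<noteq> f y3"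
    using assms irrefl proper3_neq[OF f] by metis+
  then have eq: "f y2 = f y3" using less by linarith
  obtain t where t: "E y1 t" "f t = f y3"
    using nbr_of_colour[OF \<open>y1 \<in> V\<close> f \<open>f y3 < 3\<close>] by blast
  have "t \<noteq> y1" using t irrefl by blast
  then have nt: "\<not> E y2 t" "\<not> E y3 t"
    using t eq assms proper3_neq[OF f] by metis+
  have ny: "\<not> E y2 y1" "\<not> E y3 y1" "\<not> E y2 y3" using no_K4 assms sym by blast+
  have "\<not> E v t \<or> \<not> E x t" using no_K4 assms t by blast
  then show False
    using no_chair[of v y2 y3 y1 t] no_chair[of x y2 y3 y1 t] assms nt ny t by blast
qed

lemma no_isolated:
  assumes "E v s"
  shows "\<exists>x. E v x \<and> E s x"
proof (rule ccontr)
  assume iso: "\<not> ?thesis"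
  have vs: "v \<in> V" "s \<in> V" "v \<noteq> s" using assms E_in irrefl by blast+
  obtain f where f: "proper3 E (V - {s}) f" using critical vs by blast
  have "f v < 3" using proper3_less[OF f] vs by blast
  then obtain b c where bc: "b < 3" "c < 3" "b \<noteq> c" "f v \<noteq> b" "f v \<noteq> c"
    "\<forall>k<3. k = f v \<or> k = b \<or> k = c" by (rule other_colours)
  obtain w w' where w: "E s w" "E s w'" "f w = b" "f w' = c"
    using edge_of_colours[OF \<open>s \<in> V\<close> f bc(1-3)] by blast
  have wv: "\<not> E v w" "\<not> E v w'" using iso w by blast+
  have uniq: "x = y" if "E v x" "E v y" "x \<noteq> s" "y \<noteq> s" "f x = f u" "f y = f u" "E s u" "\<not> E v u" for x y u
  proof (rule ccontr)
    assume "x \<noteq> y"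
    have "u \<noteq> s" using that irrefl by blast
    then have "\<not> E x u" "\<not> E y u" "\<not> E x y" using that proper3_neq[OF f] by metis+
    moreover have "\<not> E x s" "\<not> E y s" using iso that sym by blast+
    ultimately show False using no_chair[of v x y s u] that assms \<open>x \<noteq> y\<close> by blast
  qed
  have cases: "f x = b \<or> f x = c" if "E v x" "x \<noteq> s" for x
    using that bc(6)[rule_format, of "f x"] proper3_neq[OF f, of v x] proper3_less[OF f, of x] E_in vs by metis
  obtain g where g: "proper3 E (V - {v}) g" using critical vs by blast
  have "\<exists>x. E v x \<and> x \<noteq> s \<and> g x = i" if "i < 3" for i
  proof -
    obtain j :: nat where "j < 3" "j \<noteq> i" 
      using \<open>i < 3\<close> other_colours by metis
    then obtain x y where "E v x" "E v y" "E x y" "g x = i"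
      using edge_of_colours[OF \<open>v \<in> V\<close> g \<open>i < 3\<close>] by blast
    moreover then have "x \<noteq> s" using iso by blast
    ultimately show ?thesis by blast
  qed
  from this[of 0] this[of 1] this[of 2] obtain x y z where
    xyz: "E v x" "E v y" "E v z" "x \<noteq> s" "y \<noteq> s" "z \<noteq> s" "g x = 0" "g y = 1" "g z = 2" by auto
  then have "x \<noteq> y" "x \<noteq> z" "y \<noteq> z" by auto
  then show False
    using cases[of x] cases[of y] cases[of z] uniq[of _ _ w] uniq[of _ _ w'] xyz w wv by metis
qed

text \<open>A vertex mixed on an edge of one part is complete to the other part, which limits the
  colours available there.\<close>

lemma no_mixed_edge:
  assumes S: "S \<subseteq> {x. E v x}"
    and closed: "\<And>x y. x \<in> S \<Longrightarrow> E v y \<Longrightarrow> E x y \<Longrightarrow> y \<in> S"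
    and T: "E v t" "E v t'" "E t t'" "t \<notin> S" "t' \<notin> S"
    and w: "w \<noteq> v" "\<not> E v w" "a \<in> S" "b \<in> S" "E a b" "E w a" "\<not> E w b"
  shows False
proof -
  have closed': "\<not> E x y" if "x \<in> S" "E v y" "y \<notin> S" for x y using closed that by blast
  have complete: "E u y" if "\<not> E v u" "p \<in> S" "q \<in> S" "E p q" "E u p" "\<not> E u q" "E v y" "y \<notin> S" for u p q y
  proof -
    have "E v p" "E v q" using that S by auto
    moreover have "\<not> E p y" "\<not> E q y" using closed' that by blast+
    ultimately show ?thesis using no_bull[of u p q v y] that sym by blast
  qed
  have vV: "v \<in> V" "w \<in> V" using T w E_in by blast+
  obtain f where f: "proper3 E (V - {v}) f" using critical vV by blast
  have wT: "E w y" if "E v y" "y \<notin> S" for y using complete[OF w(2,3,4,5,6,7)] that by blast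
  have "f w < 3" using proper3_less[OF f] vV w by blast
  then obtain \<beta> \<gamma> where bc: "\<beta> < 3" "\<gamma> < 3" "\<beta> \<noteq> \<gamma>" "f w \<noteq> \<beta>" "f w \<noteq> \<gamma>"
    "\<forall>k<3. k = f w \<or> k = \<beta> \<or> k = \<gamma>" by (rule other_colours)
  have nw: "\<not> E w x" if "f x = f w" "E v x" for x 
    using proper3_neq[OF f, of w x] that w irrefl by metis
  have inS: "x \<in> S" if "f x = f w" "E v x" for x using nw wT that by blast
  have uniq: "x = y" if "f x = f w" "E v x" "f y = f w" "E v y" for x y
  proof (rule ccontr)
    assume "x \<noteq> y"
    have "\<not> E x y" using proper3_neq[OF f, of x y] that irrefl by metis
    moreover have "\<not> E x t" "\<not> E y t" using closed' inS that T by blast+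
    ultimately show False using no_chair[of v x y t w] that T w wT[of t] nw \<open>x \<noteq> y\<close> sym by metis
  qed
  obtain x a2 where x: "E v x" "f x = f w" "E v a2" "E x a2" "f a2 = \<beta>"
    using edge_of_colours[OF vV(1) f \<open>f w < 3\<close> bc(1,4)] by blast
  obtain x' a3 where x': "E v x'" "f x' = f w" "E v a3" "E x' a3" "f a3 = \<gamma>"
    using edge_of_colours[OF vV(1) f \<open>f w < 3\<close> bc(2,5)] by blast
  have "x' = x" using uniq x x' by blast
  have xS: "x \<in> S" "a2 \<in> S" "a3 \<in> S" using inS x x' closed \<open>x' = x\<close> by blast+
  have xv: "x \<noteq> v" "x \<in> V" using x irrefl E_in by blast+
  define g where "g = f(v := f w)"
  have g: "proper3 E (V - {x}) g"
  proof (rule proper3I)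
    show "g y < 3" if "y \<in> V - {x}" for y
      using that \<open>f w < 3\<close> proper3_less[OF f] by (auto simp: g_def)
    show "g y \<noteq> g z" if "y \<in> V - {x}" "z \<in> V - {x}" "E y z" for y z
      using that proper3_neq[OF f, of y z] uniq x irrefl sym by (auto simp: g_def)
  qed
  obtain p q where pq: "E x p" "E x q" "E p q" "g p = \<beta>" "g q = \<gamma>"
    using edge_of_colours[OF xv(2) g bc(1,2,3)] by blast
  have pqv: "p \<noteq> v" "q \<noteq> v" using pq bc by (auto simp: g_def)
  have pqf: "f p = \<beta>" "f q = \<gamma>" using pq pqv by (auto simp: g_def)
  have T_not: "f y \<noteq> f u" if "E v y" "y \<notin> S" "E x u" "\<not> E v u" "u \<noteq> v" "a' \<in> S" "E x a'" "f a' = f u" for y u a'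
  proof -
    have "\<not> E u a'" using proper3_neq[OF f, of u a'] that S irrefl by auto
    then have "E u y" using complete[of u x a'] that xS sym by blast
    then show ?thesis using proper3_neq[OF f, of u y] that irrefl by metis
  qed
  have tcol: "f y = \<beta> \<or> f y = \<gamma>" "y \<noteq> v" if "E v y" "y \<notin> S" for y
    using bc(6)[rule_format, of "f y"] that inS proper3_less[OF f, of y] E_in irrefl by metis+
  have "f t \<noteq> f t'" using proper3_neq[OF f] T tcol by metis
  have "\<not> E v p \<or> \<not> E v q" using no_K4[of v x p q] x pq by blast
  then show False
  proof
    assume "\<not> E v p"
    then show False 
      using T_not[of t p a2] T_not[of t' p a2] T tcol[of t] tcol[of t'] pq pqv pqf xS x \<open>f t \<noteq> f t'\<close> by metis
  next
    assume "\<not> E v q"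
    then show False 
      using T_not[of t q a3] T_not[of t' q a3] T tcol[of t] tcol[of t'] pq pqv pqf xS x' \<open>x' = x\<close> \<open>f t \<noteq> f t'\<close> by metis
  qed
qed

lemma nbhd_connected:
  assumes S: "S \<subseteq> {x. E v x}" "S \<noteq> {}"
    and closed: "\<And>x y. x \<in> S \<Longrightarrow> E v y \<Longrightarrow> E x y \<Longrightarrow> y \<in> S"
  shows "S = {x. E v x}"
proof (rule ccontr)
  assume "S \<noteq> {x. E v x}"
  then obtain s t where s: "s \<in> S" "E v s" and t: "t \<notin> S" "E v t" using S by blast
  obtain s' where s': "E v s'" "E s s'" using no_isolated s by blast
  obtain t' where t': "E v t'" "E t t'" using no_isolated t by blast
  have s'S: "s' \<in> S" using closed s s' by blast
  have t'S: "t' \<notin> S" using closed t t' sym by blast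
  have unmixed: "E w b" if "w \<noteq> v" "\<not> E v w" "E v a" "E v b" "E a b" "E w a" for w a b
  proof (rule ccontr)
    assume "\<not> E w b"
    show False
    proof (cases "a \<in> S")
      case True
      then show False using no_mixed_edge[of S v t t' w a b] S closed t t' t'S that \<open>\<not> E w b\<close> by blast
    next
      case False
      have cl: "y \<in> {x. E v x} - S" if "x \<in> {x. E v x} - S" "E v y" "E x y" for x y
        using that closed sym by blast
      have "b \<notin> S" using False that closed sym by blast
      then show False using no_mixed_edge[of "{x. E v x} - S" v s s' w a b] cl s s' s'S that \<open>\<not> E w b\<close> False by blast
    qed
  qed
  have vV: "v \<in> V" using s E_in by blast
  obtain f where f: "proper3 E (V - {v}) f" using critical vV by blast
  have inside: "E v w" if "E v z" "E z w" "w \<noteq> v" for z w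
  proof (rule ccontr)
    assume nvw: "\<not> E v w"
    have "f w < 3" using proper3_less[OF f] that E_in by blast
    then obtain \<beta> \<gamma> where bc: "\<beta> < 3" "\<gamma> < 3" "\<beta> \<noteq> \<gamma>" "f w \<noteq> \<beta>" "f w \<noteq> \<gamma>"
      by (rule other_colours)
    obtain x a2 where x: "E v x" "f x = f w" "E v a2" "E x a2" "f a2 = \<beta>"
      using edge_of_colours[OF vV f \<open>f w < 3\<close> bc(1,4)] by blast
    obtain x' a3 where x': "E v x'" "f x' = f w" "E v a3" "E x' a3" "f a3 = \<gamma>"
      using edge_of_colours[OF vV f \<open>f w < 3\<close> bc(2,5)] by blast
    have "\<not> E w x" "\<not> E w x'" 
      using proper3_neq[OF f, of w x] proper3_neq[OF f, of w x'] that x x' irrefl by metis+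
    then have nw: "\<not> E w x" "\<not> E w x'" "\<not> E w a2" "\<not> E w a3"
      using unmixed[of w] that nvw x x' sym by blast+
    have clique: "E y y'" if "E v y" "E v y'" "y \<noteq> y'" "\<not> E w y" "\<not> E w y'" for y y'
    proof -
      have "\<not> E z y" "\<not> E z y'" using unmixed[of w z] that nvw \<open>E v z\<close> \<open>E z w\<close> \<open>w \<noteq> v\<close> sym by blast+
      then show ?thesis
        using no_chair[of v y y' z w] that nvw \<open>E v z\<close> \<open>E z w\<close> sym by blast
    qed
    have "a2 \<noteq> a3" using x x' bc by auto
    have "x \<noteq> a2" "x \<noteq> a3" using x x' bc by auto
    then show False
      using no_K4[of v x a2 a3] clique[of x a3] clique[of a2 a3] nw x x' \<open>a2 \<noteq> a3\<close> by blast
  qed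
  have sV: "s \<in> V" "s \<noteq> v" using s E_in irrefl by blast+
  obtain g where g: "proper3 E (V - {s}) g" using critical sV by blast
  have "g v < 3" using proper3_less[OF g] vV sV by blast
  then obtain \<beta> \<gamma> where bc: "\<beta> < 3" "\<gamma> < 3" "\<beta> \<noteq> \<gamma>" "g v \<noteq> \<beta>" "g v \<noteq> \<gamma>"
    by (rule other_colours)
  obtain p q where "E s p" "E s q" "E p q" "g p = \<beta>" "g q = \<gamma>"
    using edge_of_colours[OF sV(1) g bc(1,2,3)] by blast
  then show False using inside[OF s(2)] no_K4[of v s p q] s bc by blast
qed

lemma nbhd_not_P3_or_C4:
  assumes "v \<in> V" "\<And>x. E v x \<Longrightarrow> x = a \<or> x = b \<or> x = c \<or> x = d" "\<not> E a c" "\<not> E b d"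
    "E a b" "E b c"  "E v a" "E v b" "E v c"
    "E v d \<Longrightarrow> E c d \<and> E d a"
  shows False
proof -
  obtain f where f: "proper3 E (V - {v}) f" using critical assms by blast
  have less: "f a < 3" "f b < 3" "f c < 3" "E v d \<Longrightarrow> f d < 3"
    using proper3_less[OF f] assms E_in irrefl by metis+
  have neq: "f a \<noteq> f b" "f b \<noteq> f c" "E v d \<Longrightarrow> f c \<noteq> f d \<and> f d \<noteq> f a" 
    using proper3_neq[OF f] assms irrefl by metis+
  note ed = edge_of_colours[OF assms(1) f]
  show False
  proof (cases "f a = f c")
    case True
    obtain \<beta> \<gamma> where bc: "\<beta> < 3" "\<gamma> < 3" "\<beta> \<noteq> \<gamma>" "f a \<noteq> \<beta>" "f a \<noteq> \<gamma>"
      using less(1) by (rule other_colours)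
    obtain p q where "E v p" "E v q" "E p q" "f p = \<beta>" "f q = \<gamma>" using ed bc by blast
    then show False using assms(2)[of p] assms(2)[of q] assms(4) True bc sym irrefl by metis
  next
    case False
    obtain p q where pq: "E v p" "E v q" "E p q" "f p = f a" "f q = f c" using ed less False by blast
    have "E v d \<Longrightarrow> f d = f b" using neq less False by linarith
    then have "p = a" "q = c" using assms(2)[of p] assms(2)[of q] neq False pq by metis+
    then show False using pq assms by blast
  qed
qed

lemma no_C4_in_nbhd:
  assumes "E v a" "E v b" "E v c" "E v d" "E a b" "E b c" "E c d" "E d a" "a \<noteq> c" "b \<noteq> d"
  shows False
proof -
  have n: "\<not> E a c" "\<not> E b d" using no_K4[of v] assms sym by blast+
  have "{a, b, c, d} = {x. E v x}"
  proof (rule nbhd_connected)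
    fix x y assume "x \<in> {a, b, c, d}" "E v y" "E x y"
    then show "y \<in> {a, b, c, d}"
      using common_nbrs_le_2[of v a b d y] common_nbrs_le_2[of v b a c y]
        common_nbrs_le_2[of v c b d y] common_nbrs_le_2[of v d a c y] assms sym by auto
  qed (use assms in auto)
  then show False using nbhd_not_P3_or_C4[of v a b c d] assms n E_in[of v a] by blast
qed

lemma P3_extends_to_P4:
  assumes "E v a" "E v b" "E v c" "E a b" "E b c" "a \<noteq> c"
  obtains x where "E v x" "x \<noteq> b" "E a x \<and> \<not> E c x \<or> \<not> E a x \<and> E c x" "\<not> E b x"
proof -
  have n: "\<not> E a c" using no_K4[of v] assms by blast
  have "{a, b, c} \<noteq> {x. E v x}"
  proof
    assume "{a, b, c} = {x. E v x}"
    then show False using nbhd_not_P3_or_C4[of v a b c b] assms n E_in[of v a] sym irrefl by blast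
  qed
  then obtain x y where xy: "x \<in> {a, b, c}" "E v y" "E x y" "y \<notin> {a, b, c}"
    using nbhd_connected[of "{a, b, c}" v] assms by blast
  have "\<not> E b y" using common_nbrs_le_2[of v b a c y] assms sym xy by blast
  moreover have "\<not> (E a y \<and> E c y)" using no_C4_in_nbhd[of v a b c y] assms xy sym by blast
  ultimately show ?thesis using that[of y] xy by blast
qed

lemma P4_outer_vertex:
  assumes p: "E v p1" "E v p2" "E v p3" "E v p4" "E p1 p2" "E p2 p3" "E p3 p4"
    and np: "\<not> E p1 p3" "\<not> E p2 p4" "\<not> E p1 p4" "p1 \<noteq> p3" "p2 \<noteq> p4"
  obtains w where "E w p1" "E w p2" "\<not> E w v" "\<not> E w p3" "w \<noteq> v"
proof -
  obtain w where w: "E p2 w" "w \<noteq> v" "E p1 w \<and> \<not> E p3 w \<or> \<not> E p1 w \<and> E p3 w" "\<not> E v w"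
    using P3_extends_to_P4[of p2 p1 v p3] p np sym by metis
  have "\<not> E p3 w"
  proof
    assume a: "E p3 w"
    then have "\<not> E p1 w" using w by blast
    have "\<not> E p4 w" using no_C4_in_nbhd[of p3 p2 v p4 w] p np sym w a by blast
    then show False using no_bull[of w p2 p1 v p4] p np w \<open>\<not> E p1 w\<close> sym by blast
  qed
  then show ?thesis using that w sym by blast
qed

lemma no_vertices: "V = {}"
proof (rule ccontr)
  assume "V \<noteq> {}"
  then obtain v where v: "v \<in> V" by blast
  obtain f where f: "proper3 E (V - {v}) f" using critical v by blast
  obtain a where a: "E v a" using nbr_of_colour[OF v f, of 0] by auto
  obtain b where b: "E v b" "E a b" using no_isolated a by blast
  have "{a, b} \<noteq> {x. E v x}"
  proof
    assume "{a, b} = {x. E v x}"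
    then show False using third_neighbour[OF v, of a b] by blast
  qed
  then obtain x y where xy: "x \<in> {a, b}" "E v y" "E x y" "y \<notin> {a, b}"
    using nbhd_connected[of "{a, b}" v] a b by blast
  have "\<exists>p q r. E v p \<and> E v q \<and> E v r \<and> E p q \<and> E q r \<and> p \<noteq> r"
  proof (cases "x = a")
    case True
    then show ?thesis using xy a b sym[OF b(2)] by blast
  next
    case False
    then show ?thesis using xy a b by blast
  qed
  then obtain p q r where pqr: "E v p" "E v q" "E v r" "E p q" "E q r" "p \<noteq> r" by blast
  obtain s where s: "E v s" "s \<noteq> q" "E p s \<and> \<not> E r s \<or> \<not> E p s \<and> E r s" "\<not> E q s"
    using P3_extends_to_P4[OF pqr] by blast
  have "\<not> E p r" using no_K4[of v] pqr by blast
  have "\<exists>p1 p2 p3 p4. E v p1 \<and> E v p2 \<and> E v p3 \<and> E v p4 \<and> E p1 p2 \<and> E p2 p3 \<and> E p3 p4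
      \<and> \<not> E p1 p3 \<and> \<not> E p2 p4 \<and> \<not> E p1 p4 \<and> p1 \<noteq> p3 \<and> p2 \<noteq> p4"
  proof (cases "E p s")
    case True
    then have "E s p" "\<not> E s q" "\<not> E s r" using s sym by blast+
    then show ?thesis using \<open>\<not> E p r\<close> s(1,2) pqr by blast
  next
    case False
    then have "E r s" using s by blast
    then show ?thesis using \<open>\<not> E p r\<close> False s(1,2,4) pqr by blast
  qed
  then obtain p1 p2 p3 p4 where p: "E v p1" "E v p2" "E v p3" "E v p4" "E p1 p2" "E p2 p3" "E p3 p4"
    and np: "\<not> E p1 p3" "\<not> E p2 p4" "\<not> E p1 p4" "p1 \<noteq> p3" "p2 \<noteq> p4" by blast
  obtain w where w: "E w p1" "E w p2" "\<not> E w v" "\<not> E w p3" "w \<noteq> v"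
    using P4_outer_vertex[OF p np] .
  obtain z where z: "E z p4" "E z p3" "\<not> E z v" "\<not> E z p2" "z \<noteq> v"
  proof (rule P4_outer_vertex[of v p4 p3 p2 p1])
    show "\<not> E p4 p2" "\<not> E p3 p1" "\<not> E p4 p1" "p4 \<noteq> p2" "p3 \<noteq> p1" using np sym by blast+
  qed (use p sym in blast)+
  have "E w z" using no_bull[of w p2 v p3 z] p w z sym by blast
  have "diamond E w p1 p2 v" "diamond E v p3 p4 z"
    using p w z sym by (auto simp: diamond_def)
  moreover have "distinct [w, p1, p2, v, p3, p4, z]"
    using p np w z sym irrefl by (simp; metis)
  ultimately show False using no_moser \<open>E w z\<close> sym by blast
qed

end

section \<open>Translation to pair digraphs\<close>

lemma contains_inducedI:
  assumes G: "pair_wf_digraph G" and H: "parcs H \<subseteq> pverts H \<times> pverts H"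
    and inj: "inj_on f (pverts H)" and V: "f ` pverts H \<subseteq> pverts G"
    and E: "\<And>x y. x \<in> pverts H \<Longrightarrow> y \<in> pverts H \<Longrightarrow> (f x, f y) \<in> parcs G \<longleftrightarrow> (x, y) \<in> parcs H"
  shows "contains_induced G H"
proof -
  define K where "K = \<lparr>pverts = f ` pverts H, parcs = map_prod f f ` parcs H\<rparr>"
  have wfH: "pair_wf_digraph H" and wfK: "pair_wf_digraph K"
    using H by (auto simp: pair_wf_digraph_def K_def)
  have arcs: "parcs K = {e \<in> parcs G. fst e \<in> pverts K \<and> snd e \<in> pverts K}"
  proof (intro set_eqI iffI)
    fix e assume "e \<in> parcs K"
    then show "e \<in> {e \<in> parcs G. fst e \<in> pverts K \<and> snd e \<in> pverts K}" using H E by (auto simp: K_def)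
  next
    fix e assume "e \<in> {e \<in> parcs G. fst e \<in> pverts K \<and> snd e \<in> pverts K}"
    then obtain x y where "x \<in> pverts H" "y \<in> pverts H" "e = (f x, f y)" "e \<in> parcs G"
      by (cases e) (auto simp: K_def)
    then show "e \<in> parcs K" using E by (auto simp: K_def map_prod_def intro!: image_eqI[of _ _ "(x, y)"])
  qed
  have "subgraph (with_proj K) (with_proj G)"
    unfolding subgraph_def compatible_def wf_digraph_wp_iff
    using arcs V wfK G by (auto simp: K_def)
  then have "induced_subgraph (with_proj K) (with_proj G)"
    unfolding induced_subgraph_def using arcs by auto
  moreover have "digraph_iso (with_proj H) (with_proj K)"
  proof -
    let ?h = "\<lparr>iso_verts = f, iso_arcs = map_prod f f, iso_head = snd, iso_tail = fst\<rparr>"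
    have "inj_on (map_prod f f) (parcs H)"
      using map_prod_inj_on[OF inj inj] H by (rule inj_on_subset)
    then have "pre_digraph.digraph_isomorphism (with_proj H) ?h"
      unfolding pre_digraph.digraph_isomorphism_def wf_digraph_wp_iff using inj wfH by auto
    moreover have "with_proj K = app_iso ?h (with_proj H)"
      by (simp add: app_iso_def with_proj_def K_def)
    ultimately show ?thesis unfolding digraph_iso_def by blast
  qed
  ultimately show ?thesis unfolding contains_induced_def by blast
qed

lemma chair_eq: "chair = undirected {(0, 0), (1, 1), (2, 1), (3, 1), (3, 2)}
   {((0, 0), (1, 1)), ((0, 0), (2, 1)), ((0, 0), (3, 1)), ((3, 1), (3, 2))}"
proof -
  have "{1..2::nat} = {1, 2}" by auto
  then have V: "{1::nat} \<times> {1..1::nat} \<union> {2} \<times> {1..1} \<union> {3} \<times> {1..2} = {(1, 1), (2, 1), (3, 1), (3, 2)}" by auto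
  have A: "{((0::nat, 0::nat), (a, 1::nat)) | a. (a, 1) \<in> {(1::nat, 1::nat), (2, 1), (3, 1), (3, 2)}}
     = {((0, 0), (1, 1)), ((0, 0), (2, 1)), ((0, 0), (3, 1))}" by auto
  have B: "{((a, m), (a, Suc m)) | a m. (a, m) \<in> {(1::nat, 1::nat), (2, 1), (3, 1), (3, 2)} \<and>
      (a, Suc m) \<in> {(1::nat, 1::nat), (2, 1), (3, 1), (3, 2)}} = {((3, 1), (3, 2))}" by auto
  show ?thesis
    unfolding chair_def S_graph_def V Let_def A B by (simp only: Un_insert_left Un_empty_left)
qed

lemma parcs_wheel:
  "n > 0 \<Longrightarrow> parcs (wheel n) = {(x, y). x < n \<and> y < n \<and> (x = Suc y mod n \<or> y = Suc x mod n)}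
      \<union> {(x, y). x < n \<and> y = n \<or> x = n \<and> y < n}"
  by (auto simp: wheel_def undirected_def)

text \<open>The edges of the spindle on the indices \<open>0, \<dots>, 3 p\<close> of its cycle.\<close>

definition spindle_edge :: "nat \<Rightarrow> nat \<Rightarrow> nat \<Rightarrow> bool" where
  "spindle_edge p a b \<longleftrightarrow> a < 3 * p \<and> (b = a + 1 \<or> b = a + 2 \<and> a mod 3 \<noteq> 2) \<or> a = 3 * p \<and> b = 0"

definition spindle_adj :: "nat \<Rightarrow> nat \<Rightarrow> nat \<Rightarrow> bool" where
  "spindle_adj p a b \<longleftrightarrow> a \<le> 3 * p \<and> b \<le> 3 * p \<and> (spindle_edge p a b \<or> spindle_edge p b a)"

lemma spindle_adj_inner:
  assumes "1 \<le> i" "i < p"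
  shows "spindle_adj p (3 * i) b \<longleftrightarrow> b = 3 * i - 2 \<or> b = 3 * i - 1 \<or> b = 3 * i + 1 \<or> b = 3 * i + 2"
proof -
  have "b mod 3 = 1" if "3 * i = b + 2" using that by presburger
  moreover have "(3 * i) mod 3 = 0" by simp
  ultimately show ?thesis unfolding spindle_adj_def spindle_edge_def
    using assms by (cases "3 * i = b + 2") (simp_all, linarith+)
qed

lemma spindle_adj_last:
  assumes "1 \<le> p"
  shows "spindle_adj p (3 * p) b \<longleftrightarrow> b = 3 * p - 2 \<or> b = 3 * p - 1 \<or> b = 0"
proof -
  have "b mod 3 = 1" if "3 * p = b + 2" using that by presburger
  then show ?thesis unfolding spindle_adj_def spindle_edge_def
    using assms by (cases "3 * p = b + 2") (simp_all, linarith+)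
qed

lemma spindle_adj_common:
  assumes "1 \<le> i" "i \<le> p"
  shows "spindle_adj p (3 * i - 1) b \<and> spindle_adj p (3 * i - 2) b \<longleftrightarrow> b = 3 * i - 3 \<or> b = 3 * i"
proof -
  obtain k where i: "i = k + 1" using assms by (metis le_add_diff_inverse2)
  have e: "3 * i - 1 = 3 * k + 2" "3 * i - 2 = 3 * k + 1" "3 * i - 3 = 3 * k" "3 * i = 3 * k + 3"
    unfolding i by simp_all
  have m: "3 * k + 2 \<noteq> 3 * p" "3 * k + 1 \<noteq> 3 * p" "(3 * k + 2) mod 3 = 2" "(3 * k + 1) mod 3 = 1"
    by presburger+
  have "spindle_adj p (3 * k + 2) b \<longleftrightarrow> b = 3 * k \<or> b = 3 * k + 1 \<or> b = 3 * k + 3"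
  proof -
    have "b mod 3 = 0" if "3 * k + 2 = b + 2" using that by presburger
    then show ?thesis unfolding spindle_adj_def spindle_edge_def
      using assms m i by (cases "3 * k + 2 = b + 2") (simp_all, linarith+)
  qed
  moreover have "spindle_adj p (3 * k + 1) b \<longleftrightarrow> b = 3 * k \<or> b = 3 * k + 2 \<or> b = 3 * k + 3"
  proof -
    have "b mod 3 = 2" if "3 * k + 1 = b + 2" using that by presburger
    then show ?thesis unfolding spindle_adj_def spindle_edge_def
      using assms m i by (cases "3 * k + 1 = b + 2") (simp_all, linarith+)
  qed
  ultimately show ?thesis unfolding e by auto
qed

context
  fixes G :: "'a pair_pre_digraph"
  assumes G: "pair_graph G"
begin

interpretation pair_graph G by (rule G)

abbreviation adj :: "'a \<Rightarrow> 'a \<Rightarrow> bool" where "adj x y \<equiv> (x, y) \<in> parcs G"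

lemma adj_sym: "adj x y \<Longrightarrow> adj y x"
  using arcs_symmetric by simp

lemma adj_irrefl: "\<not> adj x x"
  using no_loops' by blast

lemma adj_verts: "adj x y \<Longrightarrow> x \<in> pverts G \<and> y \<in> pverts G"
  using in_arcsD1 in_arcsD2 by blast

lemma induced_bull:
  assumes "adj a b" "adj b c" "adj c d" "adj d e" "adj b d"
    "\<not> adj a c" "\<not> adj a d" "\<not> adj a e" "\<not> adj b e" "\<not> adj c e"
  shows "contains_induced G bull"
proof -
  define f where "f i = (if i = 1 then a else if i = 2 then b else if i = 3 then c else if i = 4 then d else e)" for i :: nat
  have "{1..5::nat} = {1, 2, 3, 4, 5}" by auto
  then have verts: "pverts bull = {1, 2, 3, 4, 5}" by (simp add: bull_def undirected_def)
  have arcs: "parcs bull = {(1, 2), (2, 3), (3, 4), (4, 5), (2, 4), (2, 1), (3, 2), (4, 3), (5, 4), (4, 2)}"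
    by (auto simp: bull_def undirected_def)
  have sy: "adj b a" "adj c b" "adj d c" "adj e d" "adj d b"
    "\<not> adj c a" "\<not> adj d a" "\<not> adj e a" "\<not> adj e b" "\<not> adj e c" using assms adj_sym by blast+
  have ne: "a \<noteq> b" "a \<noteq> c" "a \<noteq> d" "a \<noteq> e" "b \<noteq> c" "b \<noteq> d" "b \<noteq> e" "c \<noteq> d" "c \<noteq> e" "d \<noteq> e"
    using assms sy adj_irrefl by metis+
  show ?thesis
  proof (rule contains_inducedI[where f = f])
    show "pair_wf_digraph G" by unfold_locales
    show "inj_on f (pverts bull)" using ne unfolding verts by (simp add: f_def)
    show "f ` pverts bull \<subseteq> pverts G" using assms adj_verts unfolding verts by (auto simp: f_def)
    show "adj (f x) (f y) \<longleftrightarrow> (x, y) \<in> parcs bull" if "x \<in> pverts bull" "y \<in> pverts bull" for x y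
      using that unfolding verts arcs
      by (elim insertE emptyE) (simp_all add: f_def assms sy adj_irrefl)
    show "parcs bull \<subseteq> pverts bull \<times> pverts bull" unfolding verts arcs by simp
  qed
qed

lemma induced_chair:
  assumes "adj m x" "adj m y" "adj m z" "adj z w" "x \<noteq> y" "\<not> adj x y" "\<not> adj x z" "\<not> adj y z"
    "\<not> adj m w" "\<not> adj x w" "\<not> adj y w"
  shows "contains_induced G chair"
proof -
  define f where "f q = (if q = (0, 0) then m else if q = (1, 1) then x else if q = (2, 1) then y
     else if q = (3, 1) then z else w)" for q :: "nat \<times> nat"
  have verts: "pverts chair = {(0, 0), (1, 1), (2, 1), (3, 1), (3, 2)}"
    by (simp add: chair_eq undirected_def)
  have arcs: "parcs chair = {((0, 0), (1, 1)), ((0, 0), (2, 1)), ((0, 0), (3, 1)), ((3, 1), (3, 2)),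
      ((1, 1), (0, 0)), ((2, 1), (0, 0)), ((3, 1), (0, 0)), ((3, 2), (3, 1))}"
    by (auto simp: chair_eq undirected_def)
  have sy: "adj x m" "adj y m" "adj z m" "adj w z" "\<not> adj y x" "\<not> adj z x" "\<not> adj z y"
    "\<not> adj w m" "\<not> adj w x" "\<not> adj w y" using assms adj_sym by blast+
  have ne: "m \<noteq> x" "m \<noteq> y" "m \<noteq> z" "m \<noteq> w" "x \<noteq> y" "x \<noteq> z" "x \<noteq> w" "y \<noteq> z" "y \<noteq> w" "z \<noteq> w"
    using assms sy adj_irrefl by metis+
  show ?thesis
  proof (rule contains_inducedI[where f = f])
    show "pair_wf_digraph G" by unfold_locales
    show "inj_on f (pverts chair)" using ne unfolding verts by (simp add: f_def)
    show "f ` pverts chair \<subseteq> pverts G" using assms adj_verts unfolding verts by (auto simp: f_def)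
    show "adj (f p) (f q) \<longleftrightarrow> (p, q) \<in> parcs chair" if "p \<in> pverts chair" "q \<in> pverts chair" for p q
      using that unfolding verts arcs
      by (elim insertE emptyE) (simp_all add: f_def assms sy adj_irrefl)
    show "parcs chair \<subseteq> pverts chair \<times> pverts chair" unfolding verts arcs by simp
  qed
qed

lemma induced_wheel:
  assumes h: "hole adj n c" and hub: "\<And>i. adj h (c i)"
  shows "\<exists>t\<ge>1. contains_induced G (wheel (2 * t + 1))"
proof -
  have n: "odd n" "n \<ge> 5" and eq: "\<And>i j. c i = c j \<longleftrightarrow> n dvd (i - j)"
    and ad: "\<And>i j. adj (c i) (c j) \<longleftrightarrow> n dvd (i - j - 1) \<or> n dvd (i - j + 1)"
    using h by (auto simp: hole_def)
  define N where "N = nat n"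
  have N: "n = int N" "N \<ge> 5" "odd N" using n by (auto simp: N_def even_nat_iff)
  define f where "f i = (if i = N then h else c (int i))" for i
  have hc: "h \<noteq> c i" "adj (c i) h" for i using hub adj_irrefl adj_sym by metis+
  have dv: "n dvd (int x - int y) \<longleftrightarrow> x mod N = y mod N" for x y
    unfolding N(1) using mod_eq_dvd_iff[of "int x" "int N" "int y"] by (metis of_nat_eq_iff zmod_int)
  have inj: "inj_on f {0..N}"
  proof (rule inj_onI)
    fix x y assume "x \<in> {0..N}" "y \<in> {0..N}" "f x = f y"
    then show "x = y" using hc(1) hc(1)[symmetric] eq[of "int x" "int y"] dv[of x y]
      by (auto simp: f_def split: if_splits)
  qed
  have rim: "adj (c (int x)) (c (int y)) \<longleftrightarrow> x = Suc y mod N \<or> y = Suc x mod N" if "x < N" "y < N" for x y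
  proof -
    have "n dvd (int x - int y - 1) \<longleftrightarrow> n dvd (int x - int (Suc y))" by (simp add: algebra_simps)
    moreover have "n dvd (int x - int y + 1) \<longleftrightarrow> n dvd (int (Suc x) - int y)" by (simp add: algebra_simps)
    ultimately show ?thesis using ad[of "int x" "int y"] dv[of x "Suc y"] dv[of "Suc x" y] that
      by (metis mod_less)
  qed
  have arcs: "parcs (wheel N) = {(x, y). x < N \<and> y < N \<and> (x = Suc y mod N \<or> y = Suc x mod N)}
      \<union> {(x, y). x < N \<and> y = N \<or> x = N \<and> y < N}"
    using N by (intro parcs_wheel) simp
  have verts: "pverts (wheel N) = {0..N}" by (simp add: wheel_def undirected_def)
  have "contains_induced G (wheel N)"
  proof (rule contains_inducedI[where f = f])
    show "pair_wf_digraph G" by unfold_locales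
    show "inj_on f (pverts (wheel N))" using inj verts by simp
    show "parcs (wheel N) \<subseteq> pverts (wheel N) \<times> pverts (wheel N)" unfolding arcs verts by auto
    show "f ` pverts (wheel N) \<subseteq> pverts G" using hub adj_verts by (auto simp: f_def)
    show "adj (f x) (f y) \<longleftrightarrow> (x, y) \<in> parcs (wheel N)"
      if xy: "x \<in> pverts (wheel N)" "y \<in> pverts (wheel N)" for x y
    proof -
      consider "x < N" "y < N" | "x < N" "y = N" | "x = N" "y < N" | "x = N" "y = N"
        using xy unfolding verts by fastforce
      then show ?thesis
        by cases (use rim[of x y] hub hc adj_irrefl in \<open>auto simp: arcs f_def\<close>)
    qed
  qed
  moreover have "N = 2 * (N div 2) + 1" "N div 2 \<ge> 1" using N by presburger+
  ultimately show ?thesis by metis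
qed

lemma induced_K4:
  assumes "adj a b" "adj a c" "adj a d" "adj b c" "adj b d" "adj c d"
  shows "contains_induced G (wheel (2 * 1 + 1))"
proof -
  define f where "f i = (if i = 0 then a else if i = 1 then b else if i = 2 then c else d)" for i :: nat
  have sy: "adj b a" "adj c a" "adj d a" "adj c b" "adj d b" "adj d c" using assms adj_sym by blast+
  have ne: "a \<noteq> b" "a \<noteq> c" "a \<noteq> d" "b \<noteq> c" "b \<noteq> d" "c \<noteq> d" using assms adj_irrefl by metis+
  have V: "{0..3::nat} = {0, 1, 2, 3}" by auto
  have verts: "pverts (wheel 3) = {0, 1, 2, 3}" by (simp add: wheel_def undirected_def V)
  have "contains_induced G (wheel 3)"
  proof (rule contains_inducedI[where f = f])
    show "pair_wf_digraph G" by unfold_locales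
    show "inj_on f (pverts (wheel 3))" using ne unfolding verts by (simp add: f_def)
    show "parcs (wheel 3) \<subseteq> pverts (wheel 3) \<times> pverts (wheel 3)"
      by (auto simp: parcs_wheel wheel_def undirected_def)
    show "f ` pverts (wheel 3) \<subseteq> pverts G" using assms adj_verts unfolding verts by (auto simp: f_def)
    show "adj (f x) (f y) \<longleftrightarrow> (x, y) \<in> parcs (wheel 3)" if "x \<in> pverts (wheel 3)" "y \<in> pverts (wheel 3)" for x y
      using that unfolding verts
      by (elim insertE emptyE) (simp_all add: f_def parcs_wheel assms sy adj_irrefl)
  qed
  then show ?thesis by simp
qed

lemma spindle_subgraph:
  assumes p: "p \<ge> 1" and inj: "inj_on u {0..3 * p}"
    and dia: "\<And>i. i < p \<Longrightarrow> diamond adj (u (3 * i)) (u (3 * i + 1)) (u (3 * i + 2)) (u (3 * i + 3))"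
    and close: "adj (u (3 * p)) (u 0)"
  shows "\<exists>H. subgraph (with_proj H) (with_proj G) \<and> spindle p H"
proof -
  define H where "H = \<lparr>pverts = u ` {0..3 * p}, parcs = {(u a, u b) | a b. spindle_adj p a b}\<rparr>"
  have D_adj: "adj (u a) (u b)" if "spindle_edge p a b" for a b
  proof (cases "a < 3 * p")
    case True
    define i where "i = a div 3"
    have i: "i < p" using True by (auto simp: i_def)
    have "a = 3 * i \<or> a = 3 * i + 1 \<or> a = 3 * i + 2" unfolding i_def by presburger
    moreover have "a mod 3 \<noteq> 2 \<Longrightarrow> a \<noteq> 3 * i + 2" by presburger
    then have "b = a + 1 \<or> b = a + 2 \<and> a \<noteq> 3 * i + 2"
      using that True unfolding spindle_edge_def by linarith
    ultimately have "a = 3 * i \<and> (b = 3 * i + 1 \<or> b = 3 * i + 2) \<or>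
        a = 3 * i + 1 \<and> (b = 3 * i + 2 \<or> b = 3 * i + 3) \<or> a = 3 * i + 2 \<and> b = 3 * i + 3"
      by linarith
    then show ?thesis using dia[OF i] unfolding diamond_def by metis
  next
    case False
    then show ?thesis using that close by (auto simp: spindle_edge_def)
  qed
  have S_adj: "adj (u a) (u b)" if "spindle_adj p a b" for a b
    using that D_adj adj_sym by (auto simp: spindle_adj_def)
  have S_sym: "spindle_adj p a b \<longleftrightarrow> spindle_adj p b a" for a b by (auto simp: spindle_adj_def)
  have nb: "nbhd H (u a) = u ` {b. spindle_adj p a b}" if "a \<le> 3 * p" for a
  proof -
    have "u a = u a' \<longleftrightarrow> a = a'" if "spindle_adj p a' b" for a' b
      using inj_on_eq_iff[OF inj, of a a'] that \<open>a \<le> 3 * p\<close> by (simp add: spindle_adj_def)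
    then show ?thesis unfolding nbhd_def H_def by auto
  qed
  have wfH: "pair_wf_digraph H" by (auto simp: pair_wf_digraph_def H_def spindle_adj_def)
  have "subgraph (with_proj H) (with_proj G)"
    unfolding subgraph_def compatible_def wf_digraph_wp_iff
  proof (intro conjI)
    have "u a \<in> pverts G" if "a \<le> 3 * p" for a
    proof (cases "a = 3 * p")
      case True
      then show ?thesis using close adj_verts by blast
    next
      case False
      then have "spindle_edge p a (a + 1)" using that by (simp add: spindle_edge_def)
      then show ?thesis using D_adj adj_verts by blast
    qed
    then show "verts (with_proj H) \<subseteq> verts (with_proj G)" by (auto simp: H_def)
    show "arcs (with_proj H) \<subseteq> arcs (with_proj G)" using S_adj by (auto simp: H_def)
  qed (simp_all add: wfH pair_wf_digraph_axioms)
  moreover have "spindle p H"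
    unfolding spindle_def
  proof (intro conjI exI[of _ u] ballI)
    have "finite (parcs H)"
    proof (rule finite_subset)
      show "parcs H \<subseteq> pverts H \<times> pverts H" by (auto simp: H_def spindle_adj_def)
    qed (simp add: H_def)
    then show "pair_graph H"
    proof unfold_locales
      show "symmetric (with_proj H)"
        unfolding symmetric_def using S_sym by (auto simp: H_def sym_def)
      show "fst e \<noteq> snd e" if e: "e \<in> parcs H" for e
      proof -
        obtain a b where "e = (u a, u b)" "spindle_adj p a b" using e by (auto simp: H_def)
        then show ?thesis using S_adj[of a b] adj_irrefl by (metis fst_conv snd_conv)
      qed
    qed (auto simp: H_def spindle_adj_def)
    show "bij_betw u {0..3 * p} (pverts H)" using inj by (simp add: bij_betw_def H_def)
    fix i
    show "(u i, u (Suc i mod (3 * p + 1))) \<in> parcs H" if "i \<in> {0..3 * p}"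
    proof -
      have "spindle_adj p i (Suc i mod (3 * p + 1))"
        using that p by (cases "i = 3 * p") (auto simp: spindle_adj_def spindle_edge_def)
      then show ?thesis by (auto simp: H_def)
    qed
    show "nbhd H (u (3 * i)) = {u (3 * i - 2), u (3 * i - 1), u (3 * i + 1), u (3 * i + 2)}" if "i \<in> {1..<p}"
    proof -
      have "1 \<le> i" "i < p" using that by auto
      then have "{b. spindle_adj p (3 * i) b} = {3 * i - 2, 3 * i - 1, 3 * i + 1, 3 * i + 2}"
        using spindle_adj_inner by auto
      then show ?thesis using nb[of "3 * i"] \<open>i < p\<close> by simp
    qed
    show "nbhd H (u (3 * i - 1)) \<inter> nbhd H (u (3 * i - 2)) = {u (3 * i - 3), u (3 * i)}" if "i \<in> {1..p}"
    proof -
      have i: "1 \<le> i" "i \<le> p" using that by auto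
      then have "{b. spindle_adj p (3 * i - 1) b} \<inter> {b. spindle_adj p (3 * i - 2) b} = {3 * i - 3, 3 * i}"
        using spindle_adj_common[OF i] by auto
      moreover have "u ` {b. spindle_adj p (3 * i - 1) b} \<inter> u ` {b. spindle_adj p (3 * i - 2) b} = u ` ({b. spindle_adj p (3 * i - 1) b} \<inter> {b. spindle_adj p (3 * i - 2) b})"
        by (rule inj_on_image_Int[OF inj, symmetric]) (auto simp: spindle_adj_def)
      ultimately show ?thesis using nb[of "3 * i - 1"] nb[of "3 * i - 2"] i by simp
    qed
  next
    have "{b. spindle_adj p (3 * p) b} = {3 * p - 2, 3 * p - 1, 0}"
      using spindle_adj_last[OF p] by auto
    then show "nbhd H (u (3 * p)) = {u (3 * p - 2), u (3 * p - 1), u 0}" using nb[of "3 * p"] by simp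
  qed
  ultimately show ?thesis by blast
qed

end

theorem theorem2:
  fixes G :: "'a pair_pre_digraph"
  assumes "pair_graph G"
    and "connected (with_proj G)"
    and "\<not> contains_induced G bull"
    and "\<not> contains_induced G chair"
  shows "(\<exists>t \<ge> 1. contains_induced G (wheel (2 * t + 1)))
    \<or> (\<exists>i \<ge> 1. \<exists>H. subgraph (with_proj H) (with_proj G) \<and> spindle i H)
    \<or> colourable 3 G"
proof (rule ccontr)
  assume "\<not> ?thesis"
  then have nw: "\<not> (\<exists>t\<ge>1. contains_induced G (wheel (2 * t + 1)))"
    and ns: "\<not> (\<exists>i\<ge>1. \<exists>H. subgraph (with_proj H) (with_proj G) \<and> spindle i H)"
    and nc: "\<not> colourable 3 G" by blast+
  interpret pair_graph G by fact
  let ?A = "\<lambda>x y. (x, y) \<in> parcs G"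
  have "\<not> (\<exists>f. proper3 ?A (pverts G) f)"
  proof
    assume "\<exists>f. proper3 ?A (pverts G) f"
    then obtain f where "proper3 ?A (pverts G) f" ..
    then have "(\<forall>v\<in>pverts G. f v < 3) \<and> (\<forall>(v, w)\<in>parcs G. f v \<noteq> f w)"
      using adj_verts[OF assms(1)] by (auto simp: proper3_def)
    then show False using nc unfolding colourable_def by blast
  qed
  moreover define P where "P W \<longleftrightarrow> W \<subseteq> pverts G \<and> \<not> (\<exists>f. proper3 ?A W f)" for W
  ultimately have "P (pverts G)" by simp
  then obtain V where "P V" and least: "\<And>W. P W \<Longrightarrow> card V \<le> card W"
    using ex_has_least_nat[of P "pverts G" card] by blast
  then have V: "V \<subseteq> pverts G" "\<not> (\<exists>f. proper3 ?A V f)" by (simp_all add: P_def)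
  have finV: "finite V" using V(1) pair_finite_verts by (rule finite_subset)
  define E where "E x y \<longleftrightarrow> ?A x y \<and> x \<in> V \<and> y \<in> V" for x y
  have proper: "proper3 E W f \<longleftrightarrow> proper3 ?A W f" if "W \<subseteq> V" for W f
    using that unfolding proper3_def E_def by blast
  note symA = adj_sym[OF assms(1)]
  interpret critical_graph V E
  proof
    show "finite V" by (rule finV)
    show "x \<in> V \<and> y \<in> V" if "E x y" for x y using that by (simp add: E_def)
    show "E y x" if "E x y" for x y using that symA by (auto simp: E_def)
    show "\<not> E x x" for x using adj_irrefl[OF assms(1)] by (simp add: E_def)
    show False if "E a b" "E b c" "E c d" "E d e" "E b d" "\<not> E a c" "\<not> E a d" "\<not> E a e" "\<not> E b e" "\<not> E c e"
      for a b c d e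
      using that induced_bull[OF assms(1), of a b c d e] assms(3) by (simp add: E_def)
    show False if "E m x" "E m y" "E m z" "E z w" "x \<noteq> y" "\<not> E x y" "\<not> E x z" "\<not> E y z"
      "\<not> E m w" "\<not> E x w" "\<not> E y w" for m x y z w
      using that induced_chair[OF assms(1), of m x y z w] assms(4) by (simp add: E_def)
    show False if "E a b" "E a c" "E a d" "E b c" "E b d" "E c d" for a b c d
    proof -
      have "contains_induced G (wheel (2 * 1 + 1))"
        using that by (intro induced_K4[OF assms(1), of a b c d]) (simp_all add: E_def)
      then show False using nw by blast
    qed
    show False if h: "hole E n r" and hub: "\<And>i. E v (r i)" for n r v
    proof -
      have "r i \<in> V" for i using hub by (simp add: E_def)
      then have "hole ?A n r" using h by (simp add: hole_def E_def)
      moreover have "?A v (r i)" for i using hub by (simp add: E_def)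
      ultimately show False using induced_wheel[OF assms(1)] nw by blast
    qed
    show False if p: "p \<ge> 1" and u: "inj_on u {0..3 * p}"
      and dia: "\<And>i. i < p \<Longrightarrow> diamond E (u (3 * i)) (u (3 * i + 1)) (u (3 * i + 2)) (u (3 * i + 3))"
      and close: "E (u (3 * p)) (u 0)" for p :: nat and u
    proof -
      have "\<exists>H. subgraph (with_proj H) (with_proj G) \<and> spindle p H"
      proof (rule spindle_subgraph[OF assms(1) p u])
        show "diamond ?A (u (3 * i)) (u (3 * i + 1)) (u (3 * i + 2)) (u (3 * i + 3))" if "i < p" for i
          using dia[OF that] unfolding diamond_def E_def by blast
        show "?A (u (3 * p)) (u 0)" using close unfolding E_def by blast
      qed
      then show False using ns p by blast
    qed
    show "\<not> proper3 E V f" for f using V proper by blast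
    show "\<exists>f. proper3 E (V - {v}) f" if "v \<in> V" for v
    proof (rule ccontr)
      assume "\<not> ?thesis"
      then have "\<not> (\<exists>f. proper3 ?A (V - {v}) f)" using proper[of "V - {v}"] by blast
      moreover have "V - {v} \<subseteq> pverts G" using V(1) by blast
      ultimately have "card V \<le> card (V - {v})" by (intro least) (simp add: P_def)
      then show False using card_Diff1_less[OF finV that] by linarith
    qed
  qed
  have "proper3 E V (\<lambda>_. 0)" using no_vertices by (simp add: proper3_def)
  then show False using not_colourable by blast
qed


end
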